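(* Let $A$ be a semisimple unital complex Banach algebra with $\dim(A)>1$. (1) Let $x\in A$ and suppose $H\subset\mathbb C$ is a hole of $\sigma(x)$. Then, for every $a\in\operatorname{soc}(A)$ such that $H\subset\sigma(x+a)$, the spectrum function $z\mapsto\sigma(z)$ on $A$ is discontinuous at $z=x+a$. (2) Hence, if $x\in A$ and there exist $H\subset\mathbb C$ and $a\in\operatorname{soc}(A)$ such that $H$ is a hole of $\sigma(x+a)$ but not a hole of $\sigma(x)$, then the spectrum function is discontinuous at $x$.
   Context: For $x\in A$, $\sigma(x)=\{\lambda\in\mathbb C:\lambda\mathbf 1-x\text{ is not invertible in }A\}$, where $\mathbf 1$ is the unit of $A$. The resolvent set of $x$ is $\rho(x)=\mathbb C\setminus\sigma(x)$; the holes of $\sigma(x)$ are the bounded connected components of $\rho(x)$. The spectrum function $z\mapsto\sigma(z)$ maps $A$ (with its norm) into the space of nonempty compact subsets of $\mathbb C$ with the Hausdorff metric, and (dis)continuity is meant with respect to these. The socle $\operatorname{soc}(A)$ of the semisimple algebra $A$ is the smallest left (equivalently, right) ideal containing all minimal left (equivalently, right) ideals of $A$, and is $\{0\}$ if there are none; it is a two-sided ideal.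
   Formalization: In (2), "not a hole of σ(x)" is read up to isolated points: no hole H' of σ(x) has H∖H' within the isolated points of σ(x) and H'∖H within those of σ(x+a). Read literally, (2) fails in C(T)⊕ℂ with x=(id,1/2), a=(0,1/2). *)

theory Defs
  imports "HOL-Analysis.Analysis"
begin

section \<open>Unital complex Banach algebras\<close>

text \<open>
  The norm of the unit is not required to be 1 (as the class \<open>real_normed_algebra_1\<close> would do);
  the norm is submultiplicative.
\<close>

class complex_banach_algebra_1 = real_normed_algebra + real_algebra_1 + banach +
  fixes scaleC :: "complex \<Rightarrow> 'a \<Rightarrow> 'a"  (infixr \<open>*\<^sub>C\<close> 75)
  assumes scaleC_add_right: "c *\<^sub>C (x + y) = c *\<^sub>C x + c *\<^sub>C y"
    and scaleC_add_left: "(c + d) *\<^sub>C x = c *\<^sub>C x + d *\<^sub>C x"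
    and scaleC_scaleC: "c *\<^sub>C d *\<^sub>C x = (c * d) *\<^sub>C x"
    and scaleC_one: "1 *\<^sub>C x = x"
    and scaleR_scaleC: "r *\<^sub>R x = complex_of_real r *\<^sub>C x"
    and mult_scaleC_left: "(c *\<^sub>C x) * y = c *\<^sub>C (x * y)"
    and mult_scaleC_right: "x * (c *\<^sub>C y) = c *\<^sub>C (x * y)"
    and norm_scaleC: "norm (c *\<^sub>C x) = cmod c * norm x"

global_interpretation complex_vector:
  vector_space "scaleC :: complex \<Rightarrow> 'a \<Rightarrow> 'a::complex_banach_algebra_1"
  by unfold_locales
    (simp_all add: scaleC_add_right scaleC_add_left scaleC_scaleC scaleC_one)

text \<open>
  The library's \<open>dim\<close> is 0 on infinite-dimensional spaces, so the dimension is expressed through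
  the cardinality of a (Hamel) basis.
\<close>

definition complex_dim_gt_one :: "'a::complex_banach_algebra_1 itself \<Rightarrow> bool" where
  "complex_dim_gt_one (_ :: 'a itself) \<longleftrightarrow>
     (\<exists>B :: 'a set. complex_vector.independent B \<and> complex_vector.span B = UNIV \<and>
        (infinite B \<or> card B > 1))"


section \<open>Left ideals, semisimplicity and the socle\<close>

text \<open>
  Since the algebra is unital, a left ideal of the ring is automatically a complex linear subspace.
\<close>

definition left_ideal :: "'a::ring_1 set \<Rightarrow> bool" where
  "left_ideal I \<longleftrightarrow> 0 \<in> I \<and> (\<forall>x\<in>I. \<forall>y\<in>I. x + y \<in> I) \<and> (\<forall>a. \<forall>x\<in>I. a * x \<in> I)"

definition maximal_left_ideal :: "'a::ring_1 set \<Rightarrow> bool" where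
  "maximal_left_ideal M \<longleftrightarrow> left_ideal M \<and> M \<noteq> UNIV \<and>
     (\<forall>I. left_ideal I \<and> M \<subseteq> I \<longrightarrow> I = M \<or> I = UNIV)"

definition minimal_left_ideal :: "'a::ring_1 set \<Rightarrow> bool" where
  "minimal_left_ideal L \<longleftrightarrow> left_ideal L \<and> L \<noteq> {0} \<and>
     (\<forall>I. left_ideal I \<and> I \<subseteq> L \<longrightarrow> I = {0} \<or> I = L)"

definition jacobson_radical :: "'a::ring_1 set" where
  "jacobson_radical = \<Inter>{M. maximal_left_ideal M}"

definition semisimple :: "'a::ring_1 itself \<Rightarrow> bool" where
  "semisimple (_ :: 'a itself) \<longleftrightarrow> jacobson_radical = ({0} :: 'a set)"

definition soc :: "'a::ring_1 set" where
  "soc = \<Inter>{I. left_ideal I \<and> (\<forall>L. minimal_left_ideal L \<longrightarrow> L \<subseteq> I)}"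


section \<open>Spectrum and holes\<close>

definition spectrum :: "'a::complex_banach_algebra_1 \<Rightarrow> complex set" where
  "spectrum x = {z. \<not> (\<exists>y. (z *\<^sub>C 1 - x) * y = 1 \<and> y * (z *\<^sub>C 1 - x) = 1)}"

definition hole :: "complex set \<Rightarrow> complex set \<Rightarrow> bool" where
  "hole H K \<longleftrightarrow> H \<in> components (- K) \<and> bounded H"

text \<open>
  For a hole \<open>H\<close> of \<open>L\<close>, being also a hole of \<open>K\<close> is understood up to isolated points of the two
  sets: a hole is the same hole after isolated points have been added to or deleted from the
  set. In the theorem \<open>K = spectrum x\<close> and \<open>L = spectrum (x + a)\<close> with \<open>a\<close> in the socle, and the
  assertion is false if ``not a hole of \<open>K\<close>'' is read as \<open>\<not> hole H K\<close>. For example,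
  let the algebra be the direct sum of \<open>C(T)\<close>, \<open>T\<close> the unit circle, and the complex numbers.
  The spectrum of \<open>(f, c)\<close> is \<open>f(T) \<union> {c}\<close>, so it is everywhere continuous, and the socle is
  \<open>0 \<oplus> \<complex>\<close>. For \<open>x = (id, 1/2)\<close> and \<open>a = (0, 1/2)\<close> the open unit disc is a hole of
  \<open>spectrum (x + a) = T\<close>, but only the disc without \<open>1/2\<close> is a hole of
  \<open>spectrum x = T \<union> {1/2}\<close>.
\<close>

definition hole_up_to_isolated :: "complex set \<Rightarrow> complex set \<Rightarrow> complex set \<Rightarrow> bool" where
  "hole_up_to_isolated H K L \<longleftrightarrow>
     (\<exists>H'. hole H' K \<and> H - H' \<subseteq> {z. z isolated_in K} \<and> H' - H \<subseteq> {z. z isolated_in L})"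


section \<open>Continuity of the spectrum function\<close>

text \<open>
  The suprema are genuine for nonempty bounded sets, in particular for nonempty compact ones.
\<close>

definition hausdorff_distance :: "'a::metric_space set \<Rightarrow> 'a set \<Rightarrow> real" where
  "hausdorff_distance K L = max (SUP z\<in>K. infdist z L) (SUP z\<in>L. infdist z K)"

definition spectrum_continuous_at :: "'a::complex_banach_algebra_1 \<Rightarrow> bool" where
  "spectrum_continuous_at x \<longleftrightarrow>
     ((\<lambda>z. hausdorff_distance (spectrum z) (spectrum x)) \<longlongrightarrow> 0) (at x)"

end

(*
  An element a of the socle is a finite sum of u_j e_j with minimal idempotents e_j, and the
  corners e_i A e_j are at most one-dimensional by the Gelfand-Mazur theorem. Hence a has "finite
  rank": for z in the resolvent set of x, with resolvent R(z), the factorisation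
  z - (x + l a) = (1 - l a R(z)) (z - x) shows that z lies in the spectrum of x + l a if and only
  if a finite product D(z, l) of determinants vanishes. D is holomorphic in z, polynomial in l,
  and D(z, 0) = 1.

  (1) If D(., 1) vanishes on a hole H, divide D by the largest power of l - 1 that divides it for
  all z in H. The quotient is nonzero at some (z, 1), hence nearby, so the spectra of x + l a with
  l near 1, l /= 1, avoid a fixed ball around the point z of the spectrum of x + a.

  (2) If H is a hole of the spectrum of x + a contained in the spectrum of x, apply (1) to x + a
  and -a. Otherwise the zeros of the determinant in a component of a resolvent set are isolated
  and do not disconnect it, so H is up to isolated points a component of the resolvent set of x.
*)

theory Submission
  imports "HOL-Complex_Analysis.Complex_Analysis" "Jordan_Normal_Form.Determinant" Defs
begin

section \<open>Invertibility and the resolvent\<close>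

lemma norm_power_le:
  fixes x :: "'a::{real_normed_algebra, ring_1}"
  shows "norm (x ^ n) \<le> norm (1 :: 'a) * norm x ^ n"
proof (induction n)
  case (Suc n)
  have "norm (x ^ Suc n) \<le> norm (x ^ n) * norm x"
    unfolding power_Suc2 by (rule norm_mult_ineq)
  also have "\<dots> \<le> (norm (1 :: 'a) * norm x ^ n) * norm x"
    using Suc by (rule mult_right_mono) simp
  finally show ?case by (simp add: ac_simps)
qed simp

definition inverse_of :: "'a::ring_1 \<Rightarrow> 'a \<Rightarrow> bool" where
  "inverse_of q p \<longleftrightarrow> p * q = 1 \<and> q * p = 1"

definition unit_elem :: "'a::ring_1 \<Rightarrow> bool" where
  "unit_elem p \<longleftrightarrow> (\<exists>q. inverse_of q p)"

lemma inverse_of_sym: "inverse_of q p \<Longrightarrow> inverse_of p q"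
  unfolding inverse_of_def by simp

lemma inverse_of_mult: "inverse_of q p \<Longrightarrow> inverse_of q' p' \<Longrightarrow> inverse_of (q' * q) (p * p')"
  unfolding inverse_of_def by (metis mult.assoc mult_1_left)

lemma unit_elem_mult: "unit_elem p \<Longrightarrow> unit_elem q \<Longrightarrow> unit_elem (p * q)"
  unfolding unit_elem_def by (blast intro: inverse_of_mult)

lemma unit_elem_mult_right_iff:
  assumes "unit_elem q" shows "unit_elem (p * q) \<longleftrightarrow> unit_elem p"
proof
  obtain s where s: "inverse_of s q" using assms unfolding unit_elem_def by blast
  assume "unit_elem (p * q)"
  moreover have "unit_elem s" using s inverse_of_sym unfolding unit_elem_def by blast
  ultimately have "unit_elem (p * q * s)" by (rule unit_elem_mult)
  then show "unit_elem p" using s unfolding inverse_of_def by (simp add: mult.assoc)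
qed (simp add: unit_elem_mult assms)

text \<open>The inverse is the geometric series. It converges because the powers decay like those of
  \<open>norm h\<close>, up to the constant \<open>norm 1\<close>, which may differ from 1.\<close>

lemma Neumann:
  fixes h :: "'a::{real_normed_algebra, ring_1, banach}"
  assumes "norm h < 1" shows "unit_elem (1 - h)"
proof -
  have "summable (\<lambda>n. norm (1 :: 'a) * norm h ^ n)"
    using assms by (intro summable_mult summable_geometric) simp
  then have S: "summable (\<lambda>n. h ^ n)"
    by (rule summable_comparison_test') (rule norm_power_le)
  define q where "q = (\<Sum>n. h ^ n)"
  have q: "q = 1 + (\<Sum>n. h ^ Suc n)" unfolding q_def using suminf_split_head[OF S] by simp
  have "(\<Sum>n. h ^ Suc n) = h * q" unfolding q_def power_Suc by (rule suminf_mult[OF S])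
  moreover have "(\<Sum>n. h ^ Suc n) = q * h"
    unfolding q_def power_Suc2 by (rule suminf_mult2[OF S, symmetric])
  ultimately have "q - h * q = 1" "q - q * h = 1" using q by (simp_all add: algebra_simps)
  then have "inverse_of q (1 - h)"
    unfolding inverse_of_def by (simp add: left_diff_distrib right_diff_distrib)
  then show ?thesis unfolding unit_elem_def by blast
qed

text \<open>The term \<open>h * q\<close> is absorbed into the left side. This bounds an inverse
  \<open>q\<close> whose size is not known in advance.\<close>

lemma norm_inverse_le:
  fixes h q :: "'a::{real_normed_algebra, ring_1}"
  assumes "q = p + h * q" "norm h \<le> 1 / 2"
  shows "norm q \<le> 2 * norm p"
proof -
  have "norm q \<le> norm p + norm (h * q)" by (subst assms(1)) (rule norm_triangle_ineq)
  also have "norm (h * q) \<le> 1 / 2 * norm q"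
    using norm_mult_ineq[of h q] mult_right_mono[OF assms(2), of "norm q"] by simp
  finally show ?thesis by simp
qed

text \<open>The factorisation \<open>p - d = (1 - d * q) * p\<close> reduces this to the Neumann
  series.\<close>

lemma unit_elem_perturb:
  fixes p :: "'a::{real_normed_algebra, ring_1, banach}"
  assumes q: "inverse_of q p" and d: "norm d * norm q < 1"
  shows "unit_elem (p - d)"
proof -
  have "unit_elem (1 - d * q)"
    using d norm_mult_ineq[of d q] by (intro Neumann) simp
  then have "unit_elem ((1 - d * q) * p)"
    using q by (intro unit_elem_mult) (auto simp: unit_elem_def)
  moreover have "(1 - d * q) * p = p - d"
    using q unfolding inverse_of_def by (simp add: algebra_simps)
  ultimately show ?thesis by simp
qed

text \<open>The identity \<open>q' = q + q * d * q'\<close> first gives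
  \<open>norm q' \<le> 2 * norm q\<close>; used a second time, it gives an error linear in
  \<open>norm d\<close>.\<close>

lemma inverse_perturb_bound:
  fixes p :: "'a::{real_normed_algebra, ring_1}"
  assumes q: "inverse_of q p" and q': "inverse_of q' (p - d)" and d: "norm q * norm d \<le> 1 / 2"
  shows "norm (q' - q) \<le> 2 * norm q * norm q * norm d"
proof -
  have eq: "q' = q + q * d * q'"
  proof -
    have "q * ((p - d) * q') = q" using q' unfolding inverse_of_def by simp
    moreover have "q * ((p - d) * q') = q * p * q' - q * d * q'" by (simp add: algebra_simps)
    ultimately show ?thesis using q unfolding inverse_of_def by (simp add: algebra_simps)
  qed
  have nqd: "norm (q * d) \<le> norm q * norm d" by (rule norm_mult_ineq)
  have nq': "norm q' \<le> 2 * norm q"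
    by (rule norm_inverse_le[OF eq]) (use nqd d in linarith)
  have "q' - q = q * d * q'" by (subst eq) simp
  then have "norm (q' - q) = norm (q * d * q')" by simp
  also have "\<dots> \<le> norm (q * d) * norm q'" by (rule norm_mult_ineq)
  also have "\<dots> \<le> (norm q * norm d) * (2 * norm q)"
    using nqd nq' by (intro mult_mono) auto
  finally show ?thesis by (simp add: ac_simps)
qed

lemma continuous_on_inverse_of:
  fixes g f :: "'b::topological_space \<Rightarrow> 'a::{real_normed_algebra, ring_1}"
  assumes g: "continuous_on S g" and f: "\<And>s. s \<in> S \<Longrightarrow> inverse_of (f s) (g s)"
  shows "continuous_on S f"
  unfolding continuous_on_def
proof
  fix s assume s: "s \<in> S"
  let ?F = "at s within S"
  have "((\<lambda>t. g s - g t) \<longlongrightarrow> g s - g s) ?F"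
    using g s unfolding continuous_on_def by (intro tendsto_intros) auto
  then have d0: "((\<lambda>t. norm (g s - g t)) \<longlongrightarrow> 0) ?F"
    by (simp add: tendsto_norm_zero)
  have "((\<lambda>t. norm (f s) * norm (g s - g t)) \<longlongrightarrow> norm (f s) * 0) ?F"
    by (intro tendsto_intros d0)
  then have "\<forall>\<^sub>F t in ?F. norm (f s) * norm (g s - g t) < 1 / 2"
    by (rule order_tendstoD) simp
  moreover have "\<forall>\<^sub>F t in ?F. t \<in> S" by (simp add: eventually_at_filter)
  ultimately have "\<forall>\<^sub>F t in ?F. norm (f t - f s) \<le> 2 * norm (f s) * norm (f s) * norm (g s - g t)"
  proof eventually_elim
    case (elim t)
    then show ?case
      using inverse_perturb_bound[OF f[OF s], of "f t" "g s - g t"] f[of t] by simp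
  qed
  moreover have "((\<lambda>t. 2 * norm (f s) * norm (f s) * norm (g s - g t)) \<longlongrightarrow> 2 * norm (f s) * norm (f s) * 0) ?F"
    by (intro tendsto_intros d0)
  then have "((\<lambda>t. 2 * norm (f s) * norm (f s) * norm (g s - g t)) \<longlongrightarrow> 0) ?F" by simp
  ultimately have "((\<lambda>t. f t - f s) \<longlongrightarrow> 0) ?F"
    by (rule Lim_null_comparison)
  then show "(f \<longlongrightarrow> f s) ?F" by (rule LIM_zero_cancel)
qed

section \<open>Complex scalars and the spectrum\<close>

lemma bounded_linear_scaleC_left:
  "bounded_linear (\<lambda>c. c *\<^sub>C (x :: 'a::complex_banach_algebra_1))"
proof (rule bounded_linear_intro)
  show "(r *\<^sub>R c) *\<^sub>C x = r *\<^sub>R (c *\<^sub>C x)" for r and c :: complex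
    by (simp add: scaleR_scaleC scaleC_scaleC scaleR_conv_of_real)
  show "norm (c *\<^sub>C x) \<le> norm c * norm x" for c by (simp add: norm_scaleC)
qed (simp add: scaleC_add_left)

lemma continuous_on_scaleC_left [continuous_intros]:
  fixes x :: "'a::complex_banach_algebra_1"
  shows "continuous_on S f \<Longrightarrow> continuous_on S (\<lambda>z. f z *\<^sub>C x)"
  by (rule bounded_linear.continuous_on[OF bounded_linear_scaleC_left])

lemma tendsto_scaleC_left [tendsto_intros]:
  fixes x :: "'a::complex_banach_algebra_1"
  shows "(f \<longlongrightarrow> c) F \<Longrightarrow> ((\<lambda>z. f z *\<^sub>C x) \<longlongrightarrow> c *\<^sub>C x) F"
  by (rule bounded_linear.tendsto[OF bounded_linear_scaleC_left])

lemma scaleC_mult_one: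
  fixes x :: "'a::complex_banach_algebra_1"
  shows "(c *\<^sub>C 1) * x = c *\<^sub>C x" "x * (c *\<^sub>C 1) = c *\<^sub>C x"
  by (simp_all add: mult_scaleC_left mult_scaleC_right)

lemma scaleC_power:
  fixes x :: "'a::complex_banach_algebra_1"
  shows "(c *\<^sub>C x) ^ n = c ^ n *\<^sub>C x ^ n"
  by (induction n) (simp_all add: scaleC_one mult_scaleC_left mult_scaleC_right scaleC_scaleC)

lemma spectrum_iff: "z \<in> spectrum x \<longleftrightarrow> \<not> unit_elem (z *\<^sub>C 1 - x)"
  unfolding spectrum_def unit_elem_def inverse_of_def by simp

lemma unit_elem_scaleC:
  fixes p :: "'a::complex_banach_algebra_1"
  assumes "c \<noteq> 0" shows "unit_elem (c *\<^sub>C p) \<longleftrightarrow> unit_elem p"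
proof -
  have *: "unit_elem (c *\<^sub>C p)" if p: "unit_elem p" and c: "c \<noteq> 0" for c and p :: 'a
  proof -
    obtain q where "inverse_of q p" using p unfolding unit_elem_def by blast
    then have "inverse_of (inverse c *\<^sub>C q) (c *\<^sub>C p)"
      using c unfolding inverse_of_def
      by (simp add: mult_scaleC_left mult_scaleC_right scaleC_scaleC scaleC_one)
    then show ?thesis unfolding unit_elem_def by blast
  qed
  show ?thesis
    using *[of p c] *[of "c *\<^sub>C p" "inverse c"] assms by (auto simp: scaleC_scaleC scaleC_one)
qed

lemma spectrum_norm_le:
  fixes x :: "'a::complex_banach_algebra_1"
  assumes "z \<in> spectrum x" shows "cmod z \<le> norm x"
proof (rule ccontr)
  assume "\<not> ?thesis"
  then have z: "norm x < cmod z" by simp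
  then have z0: "z \<noteq> 0" using norm_ge_zero[of x] by auto
  have "inverse (cmod z) * norm x < 1" using z z0 by (simp add: field_simps)
  then have "unit_elem (1 - inverse z *\<^sub>C x)"
    by (intro Neumann) (simp add: norm_scaleC norm_inverse)
  then have "unit_elem (z *\<^sub>C (1 - inverse z *\<^sub>C x))" using z0 by (simp add: unit_elem_scaleC)
  moreover have "z *\<^sub>C (1 - inverse z *\<^sub>C x) = z *\<^sub>C 1 - x"
    using z0 by (simp add: complex_vector.scale_right_diff_distrib scaleC_scaleC scaleC_one)
  ultimately show False using assms by (simp add: spectrum_iff)
qed

lemma bounded_spectrum: "bounded (spectrum x)"
  using spectrum_norm_le bounded_iff by blast

lemma open_resolvent_set: "open (- spectrum x)"
  for x :: "'a::complex_banach_algebra_1"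
  unfolding open_dist
proof
  fix z assume "z \<in> - spectrum x"
  then obtain q where q: "inverse_of q (z *\<^sub>C 1 - x)" by (auto simp: spectrum_iff unit_elem_def)
  \<comment> \<open>This radius keeps \<open>norm ((z - w) *\<^sub>C 1) * norm q\<close> below 1;
    the summand 1 makes the denominator positive.\<close>
  define e where "e = 1 / (norm (1 :: 'a) * norm q + 1)"
  have K: "norm (1 :: 'a) * norm q + 1 > 0" by (simp add: add_nonneg_pos)
  have "w \<in> - spectrum x" if w: "dist w z < e" for w
  proof -
    have "cmod (z - w) * (norm (1 :: 'a) * norm q + 1) < 1"
      using w K unfolding e_def dist_norm by (simp add: norm_minus_commute pos_less_divide_eq)
    then have "cmod (z - w) * (norm (1 :: 'a) * norm q) + cmod (z - w) < 1"
      by (simp add: distrib_left)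
    then have "cmod (z - w) * (norm (1 :: 'a) * norm q) < 1"
      using norm_ge_zero[of "z - w"] by linarith
    then have "norm ((z - w) *\<^sub>C (1 :: 'a)) * norm q < 1"
      by (simp add: norm_scaleC mult.assoc)
    then have "unit_elem (z *\<^sub>C 1 - x - (z - w) *\<^sub>C 1)" using q by (rule unit_elem_perturb[rotated])
    then show ?thesis by (simp add: spectrum_iff complex_vector.scale_left_diff_distrib)
  qed
  moreover have "e > 0" unfolding e_def using K by simp
  ultimately show "\<exists>e>0. \<forall>w. dist w z < e \<longrightarrow> w \<in> - spectrum x" by blast
qed

section \<open>The resolvent and its holomorphy under functionals\<close>

definition resolvent :: "'a::complex_banach_algebra_1 \<Rightarrow> complex \<Rightarrow> 'a" where
  "resolvent x z = (SOME q. inverse_of q (z *\<^sub>C 1 - x))"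

lemma inverse_of_resolvent:
  "z \<in> - spectrum x \<Longrightarrow> inverse_of (resolvent x z) (z *\<^sub>C 1 - x)"
  unfolding resolvent_def by (rule someI_ex) (simp add: spectrum_iff unit_elem_def)

lemma continuous_on_resolvent: "continuous_on (- spectrum x) (resolvent x)"
  by (rule continuous_on_inverse_of[OF _ inverse_of_resolvent]) (intro continuous_intros)

text \<open>Place the difference of \<open>z *\<^sub>C 1 - x\<close> and
  \<open>w *\<^sub>C 1 - x\<close> between the two resolvents: each term cancels one of them, while
  the difference itself is a multiple of the unit.\<close>

lemma resolvent_identity:
  assumes "z \<in> - spectrum x" "w \<in> - spectrum x"
  shows "resolvent x w - resolvent x z = (z - w) *\<^sub>C (resolvent x w * resolvent x z)"
proof -
  let ?p = "resolvent x w" and ?q = "resolvent x z"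
  have "?p * ((z *\<^sub>C 1 - x) - (w *\<^sub>C 1 - x)) * ?q = ?p * ((z *\<^sub>C 1 - x) * ?q) - (?p * (w *\<^sub>C 1 - x)) * ?q"
    by (simp add: left_diff_distrib right_diff_distrib mult.assoc)
  also have "\<dots> = ?p - ?q"
    using assms[THEN inverse_of_resolvent] unfolding inverse_of_def by simp
  also have "(z *\<^sub>C 1 - x) - (w *\<^sub>C 1 - x) = (z - w) *\<^sub>C 1"
    by (simp add: complex_vector.scale_left_diff_distrib)
  finally show ?thesis by (simp add: scaleC_mult_one mult_scaleC_left)
qed

text \<open>\<open>bounded_linear\<close> concerns real scalars, hence the separate homogeneity for
  complex ones.\<close>

definition cfunctional :: "('a::complex_banach_algebra_1 \<Rightarrow> complex) \<Rightarrow> bool" where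
  "cfunctional \<phi> \<longleftrightarrow> bounded_linear \<phi> \<and> (\<forall>c x. \<phi> (c *\<^sub>C x) = c * \<phi> x)"

text \<open>By the resolvent identity the difference quotient is
  \<open>- \<phi> (?R w * (?R z * g))\<close>, which converges since the resolvent is continuous.
  The factor \<open>g\<close> is carried along because the matrix entries of the later determinants
  have this form.\<close>

lemma holomorphic_on_functional_resolvent:
  assumes "cfunctional \<phi>"
  shows "(\<lambda>z. \<phi> (resolvent x z * g)) holomorphic_on (- spectrum x)"
proof (rule holomorphic_onI)
  fix z assume z: "z \<in> - spectrum x"
  let ?R = "resolvent x"
  interpret bounded_linear \<phi> using assms unfolding cfunctional_def by simp
  have hom: "\<phi> (c *\<^sub>C y) = c * \<phi> y" for c y using assms unfolding cfunctional_def by simp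
  have "isCont ?R z"
    using continuous_on_resolvent open_resolvent_set z by (metis continuous_on_eq_continuous_at)
  then have "((\<lambda>w. \<phi> (?R w * (?R z * g))) \<longlongrightarrow> \<phi> (?R z * (?R z * g))) (at z)"
    unfolding isCont_def by (intro tendsto tendsto_mult tendsto_const)
  then have lim: "((\<lambda>w. - \<phi> (?R w * (?R z * g))) \<longlongrightarrow> - \<phi> (?R z * (?R z * g))) (at z)"
    by (rule tendsto_minus)
  have "\<forall>\<^sub>F w in at z. w \<in> - spectrum x"
    using open_resolvent_set z by (rule eventually_at_in_open')
  moreover have "\<forall>\<^sub>F w in at z. w \<noteq> z" by (simp add: eventually_at_filter)
  ultimately have "\<forall>\<^sub>F w in at z. - \<phi> (?R w * (?R z * g)) = (\<phi> (?R w * g) - \<phi> (?R z * g)) / (w - z)"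
  proof eventually_elim
    case (elim w)
    have "\<phi> (?R w * g) - \<phi> (?R z * g) = \<phi> ((?R w - ?R z) * g)"
      by (simp add: diff left_diff_distrib)
    also have "\<dots> = (z - w) * \<phi> (?R w * (?R z * g))"
      using elim z by (simp add: resolvent_identity mult_scaleC_left hom mult.assoc)
    finally show ?case using elim by (simp add: field_simps)
  qed
  with lim have "((\<lambda>w. (\<phi> (?R w * g) - \<phi> (?R z * g)) / (w - z)) \<longlongrightarrow> - \<phi> (?R z * (?R z * g))) (at z)"
    by (rule Lim_transform_eventually)
  then have "((\<lambda>z. \<phi> (?R z * g)) has_field_derivative - \<phi> (?R z * (?R z * g))) (at z)"
    unfolding has_field_derivative_iff .
  then show "(\<lambda>z. \<phi> (?R z * g)) field_differentiable at z within - spectrum x"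
    using field_differentiable_at_within field_differentiable_def by blast
qed

section \<open>Nonempty spectrum and the Gelfand-Mazur theorem\<close>

lemma ring_geometric_sum:
  fixes y :: "'a::ring_1"
  shows "(1 - y) * (\<Sum>j<n. y ^ j) = 1 - y ^ n" "(\<Sum>j<n. y ^ j) * (1 - y) = 1 - y ^ n"
proof (induction n)
  case (Suc n)
  { case 1 show ?case using Suc.IH(1) by (simp add: distrib_left left_diff_distrib[of 1 y "y ^ n"]) }
  { case 2 show ?case using Suc.IH(2) by (simp add: distrib_right right_diff_distrib[of "y ^ n" 1 y] power_commutes) }
qed simp_all

text \<open>The \<open>j\<close>-th power of the \<open>k\<close>-th root is the \<open>k\<close>-th
  power of the \<open>j\<close>-th root, so this is a geometric sum whose ratio differs from
  1.\<close>

lemma sum_roots_of_unity_power: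
  assumes "0 < j" "j < n"
  shows "(\<Sum>k<n. cis (2 * pi * real k / real n) ^ j) = 0"
proof -
  let ?w = "\<lambda>k. cis (2 * pi * real k / real n)"
  have inj: "inj_on ?w {..<n}"
    using Complex.bij_betw_roots_unity[of n] assms unfolding bij_betw_def by simp
  have "?w j \<noteq> ?w 0"
  proof
    assume "?w j = ?w 0"
    then have "j = 0" by (rule inj_onD[OF inj]) (use assms in auto)
    then show False using assms by simp
  qed
  then have w1: "?w j \<noteq> 1" by simp
  have "?w j ^ n = 1" using assms by (simp add: Complex.DeMoivre)
  then have "(\<Sum>k<n. ?w j ^ k) = 0" using w1 by (simp add: geometric_sum)
  moreover have "?w k ^ j = ?w j ^ k" for k by (simp add: Complex.DeMoivre mult_ac)
  ultimately show ?thesis by simp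
qed

text \<open>At each node \<open>c k\<close> of the circle, \<open>1 - (r x)^n\<close> is
  \<open>1 - c k *\<^sub>C x\<close> times a finite geometric sum. Averaging these sums over the
  roots of unity kills every power of \<open>x\<close> except the zeroth.\<close>

lemma average_inverse_of:
  fixes x :: "'a::complex_banach_algebra_1"
  assumes n: "n > 0" and f: "\<And>c. inverse_of (f c) (1 - c *\<^sub>C x)"
  shows "inverse_of ((1 / of_nat n) *\<^sub>C (\<Sum>k<n. f (r * cis (2 * pi * real k / real n))))
           (1 - (r *\<^sub>C x) ^ n)"
proof -
  define c where "c k = r * cis (2 * pi * real k / real n)" for k
  let ?Y = "(r *\<^sub>C x) ^ n"
  have cn: "c k ^ n = r ^ n" for k
    using n unfolding c_def by (simp add: power_mult_distrib Complex.DeMoivre cis_multiple_2pi)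
  have Y: "1 - ?Y = (1 - c k *\<^sub>C x) * (\<Sum>j<n. (c k *\<^sub>C x) ^ j)"
      "1 - ?Y = (\<Sum>j<n. (c k *\<^sub>C x) ^ j) * (1 - c k *\<^sub>C x)" for k
    unfolding ring_geometric_sum by (simp_all add: scaleC_power cn)
  have 1: "f (c k) * (1 - ?Y) = (\<Sum>j<n. (c k *\<^sub>C x) ^ j)" for k
    unfolding Y(1)[of k] using f[of "c k"] unfolding inverse_of_def by (simp flip: mult.assoc)
  have 2: "(1 - ?Y) * f (c k) = (\<Sum>j<n. (c k *\<^sub>C x) ^ j)" for k
    unfolding Y(2)[of k] using f[of "c k"] unfolding inverse_of_def by (simp add: mult.assoc)
  have "(\<Sum>k<n. \<Sum>j<n. (c k *\<^sub>C x) ^ j) = (\<Sum>j<n. (\<Sum>k<n. c k ^ j) *\<^sub>C x ^ j)"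
    by (subst sum.swap) (simp add: scaleC_power complex_vector.scale_sum_left)
  also have "\<dots> = (\<Sum>j<n. if j = 0 then of_nat n *\<^sub>C 1 else 0)"
  proof (rule sum.cong)
    fix j assume "j \<in> {..<n}"
    then have "j > 0 \<Longrightarrow> (\<Sum>k<n. c k ^ j) = 0"
      using sum_roots_of_unity_power[of j n]
      by (simp add: c_def power_mult_distrib flip: sum_distrib_left)
    then show "(\<Sum>k<n. c k ^ j) *\<^sub>C x ^ j = (if j = 0 then of_nat n *\<^sub>C 1 else 0)" by auto
  qed simp
  also have "\<dots> = of_nat n *\<^sub>C 1" using n by simp
  finally have "(1 / of_nat n) *\<^sub>C (\<Sum>k<n. \<Sum>j<n. (c k *\<^sub>C x) ^ j) = 1"
    using n by (simp add: scaleC_scaleC scaleC_one)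
  then show ?thesis
    unfolding inverse_of_def c_def[symmetric]
    by (simp add: mult_scaleC_left mult_scaleC_right sum_distrib_left sum_distrib_right 1 2)
qed

text \<open>Rickart's replacement for the Cauchy integral: the averages of the entire function
  \<open>c \<mapsto> (1 - c x)\<^sup>-\<^sup>1\<close> over the \<open>n\<close>-th roots of unity on the circle of radius \<open>r\<close> are
  \<open>(1 - (r x)\<^sup>n)\<^sup>-\<^sup>1\<close>. Uniform continuity makes these averages nearly independent of \<open>r\<close>, so
  convergence of \<open>(r x)\<^sup>n\<close> to 0 propagates from each radius to slightly larger ones.\<close>

lemma scaled_powers_tendsto_0:
  fixes x :: "'a::complex_banach_algebra_1"
  assumes unit: "\<And>c. unit_elem (1 - c *\<^sub>C x)" and R: "R > 0"
  shows "(\<lambda>n. norm ((complex_of_real R *\<^sub>C x) ^ n)) \<longlonglongrightarrow> 0"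
proof -
  define Q where "Q r \<longleftrightarrow> (\<lambda>n. norm ((complex_of_real r *\<^sub>C x) ^ n)) \<longlonglongrightarrow> 0" for r
  obtain f where f: "\<And>c. inverse_of (f c) (1 - c *\<^sub>C x)"
    using unit unfolding unit_elem_def by metis
  define F where
    "F n r = (1 / of_nat n) *\<^sub>C (\<Sum>k<n. f (complex_of_real r * cis (2 * pi * real k / real n)))"
    for n r
  have F: "inverse_of (F n r) (1 - (complex_of_real r *\<^sub>C x) ^ n)" if "n > 0" for n r
    unfolding F_def using that f by (rule average_inverse_of)
  have "continuous_on (cball 0 (R + 1)) f"
    by (rule continuous_on_inverse_of[OF _ f]) (intro continuous_intros)
  then have "uniformly_continuous_on (cball 0 (R + 1)) f"
    by (rule compact_uniformly_continuous) simp
  then obtain d where d: "d > 0" and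
    df: "\<And>c c'. c \<in> cball 0 (R + 1) \<Longrightarrow> c' \<in> cball 0 (R + 1) \<Longrightarrow> dist c c' < d \<Longrightarrow> dist (f c) (f c') < 1 / 8"
    unfolding uniformly_continuous_on_def by (metis zero_less_divide_1_iff zero_less_numeral)
  have near: "norm (F n s - F n r) \<le> 1 / 8"
    if "n > 0" "0 \<le> r" "r \<le> R + 1" "0 \<le> s" "s \<le> R + 1" "\<bar>s - r\<bar> < d" for n r s
  proof -
    let ?w = "\<lambda>k. cis (2 * pi * real k / real n)"
    have "norm (f (complex_of_real s * ?w k) - f (complex_of_real r * ?w k)) \<le> 1 / 8" for k
    proof -
      have "dist (complex_of_real s * ?w k) (complex_of_real r * ?w k) = \<bar>s - r\<bar>"
        by (simp add: dist_norm norm_mult flip: left_diff_distrib of_real_diff)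
      then show ?thesis
        using df[of "complex_of_real s * ?w k" "complex_of_real r * ?w k"] that
        by (simp add: norm_mult dist_norm[of "f _"])
    qed
    then have "norm (\<Sum>k<n. f (complex_of_real s * ?w k) - f (complex_of_real r * ?w k)) \<le> (\<Sum>k<n. 1 / 8)"
      by (intro sum_norm_le) auto
    moreover have "F n s - F n r =
        (1 / of_nat n) *\<^sub>C (\<Sum>k<n. f (complex_of_real s * ?w k) - f (complex_of_real r * ?w k))"
      unfolding F_def sum_subtractf complex_vector.scale_right_diff_distrib ..
    ultimately show ?thesis using \<open>n > 0\<close> by (simp add: norm_scaleC norm_divide field_simps)
  qed
  \<comment> \<open>Convergence at \<open>r\<close> only gives boundedness of the powers at the
    slightly larger \<open>s\<close>; the factor \<open>(t / s) ^ n\<close> then restores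
    convergence for every \<open>t\<close> below \<open>s\<close>.\<close>
  have step: "Q t" if Q: "Q r" and r: "0 \<le> r" and s: "t < s" "s \<le> R + 1" "\<bar>s - r\<bar> < d" and t: "0 \<le> t" "r \<le> R + 1"
    for r s t
  proof -
    define N where "N = norm (1 :: 'a)"
    have N0: "N \<ge> 0" unfolding N_def by simp
    let ?Y = "\<lambda>r n. (complex_of_real r *\<^sub>C x) ^ n"
    have lim: "(\<lambda>n. N * norm (?Y r n)) \<longlonglongrightarrow> N * 0" "(\<lambda>n. 2 * N * N * norm (?Y r n)) \<longlonglongrightarrow> 2 * N * N * 0"
      using Q unfolding Q_def by (intro tendsto_intros; simp)+
    have "\<forall>\<^sub>F n in sequentially. N * norm (?Y r n) < 1 / 2"
      by (rule order_tendstoD(2)[OF lim(1)]) simp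
    moreover have "\<forall>\<^sub>F n in sequentially. 2 * N * N * norm (?Y r n) < 1 / 8"
      by (rule order_tendstoD(2)[OF lim(2)]) simp
    ultimately have "\<forall>\<^sub>F n in sequentially. norm (?Y s n) \<le> 3 * N"
      using eventually_gt_at_top[of "0 :: nat"]
    proof eventually_elim
      case (elim n)
      have "inverse_of (1 :: 'a) 1" unfolding inverse_of_def by simp
      from inverse_perturb_bound[OF this F[OF elim(3), of r]]
      have "norm (F n r - 1) \<le> 1 / 8" using elim unfolding N_def by simp
      moreover have "norm (F n s - F n r) \<le> 1 / 8" using elim r s t by (intro near) auto
      ultimately have "norm (F n s - 1) \<le> 1 / 2"
        using norm_triangle_ineq[of "F n s - F n r" "F n r - 1"] by simp
      then have h: "norm (1 - F n s) \<le> 1 / 2" by (simp add: norm_minus_commute)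
      \<comment> \<open>The two errors of 1/8 put \<open>F n s\<close> within 1/2 of 1, so its
        inverse \<open>1 - ?Y s n\<close> is bounded independently of \<open>n\<close>.\<close>
      have "norm (1 - ?Y s n) \<le> 2 * norm (1 :: 'a)"
      proof (rule norm_inverse_le[OF _ h])
        show "1 - ?Y s n = 1 + (1 - F n s) * (1 - ?Y s n)"
          using F[OF elim(3), of s] unfolding inverse_of_def by (simp add: left_diff_distrib)
      qed
      then show ?case
        using norm_triangle_ineq4[of 1 "1 - ?Y s n"] unfolding N_def by simp
    qed
    then have "\<forall>\<^sub>F n in sequentially. norm (norm (?Y t n)) \<le> (t / s) ^ n * (3 * N)"
    proof eventually_elim
      case (elim n)
      have "t / s * s = t" using s t by simp
      then have "complex_of_real (t / s) * complex_of_real s = complex_of_real t"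
        by (metis of_real_mult)
      then have "complex_of_real t *\<^sub>C x = complex_of_real (t / s) *\<^sub>C (complex_of_real s *\<^sub>C x)"
        by (simp only: scaleC_scaleC)
      then have "?Y t n = complex_of_real (t / s) ^ n *\<^sub>C ?Y s n"
        by (simp only: scaleC_power[of "complex_of_real (t / s)"])
      moreover have "cmod (complex_of_real (t / s) ^ n) = (t / s) ^ n"
        unfolding norm_power norm_of_real using s t by simp
      ultimately have "norm (?Y t n) = (t / s) ^ n * norm (?Y s n)" by (simp only: norm_scaleC)
      then show ?case using elim s t by (simp add: mult_left_mono)
    qed
    moreover have "norm (t / s) < 1" using s t by simp
    then have "(\<lambda>n. (t / s) ^ n * (3 * N)) \<longlonglongrightarrow> 0"
      by (intro tendsto_mult_left_zero LIMSEQ_power_zero)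
    ultimately show ?thesis unfolding Q_def by (rule Lim_null_comparison)
  qed
  \<comment> \<open>The interval from 0 to \<open>R\<close> is cut into \<open>M\<close> pieces of
    length \<open>h\<close>. Each step passes from \<open>r\<close> to \<open>t = r + h\<close> with
    \<open>s = r + 2 * h\<close>, so \<open>2 * h\<close> has to be below 1, to keep
    \<open>s \<le> R + 1\<close>, and below \<open>d\<close>.\<close>
  obtain M where M: "real M > 2 * R / d + 2 * R" using reals_Archimedean2 by blast
  have M0: "real M > 0" using M R d by (smt (verit) divide_pos_pos)
  define h where "h = R / M"
  have h: "h > 0" unfolding h_def using M0 R by simp
  have "2 * R / d > 0" using R d by simp
  then have "2 * R < real M * 1" "2 * R / d < real M" using M R by linarith+
  then have h2: "2 * h < 1" "2 * h < d" unfolding h_def using M0 d by (simp_all add: field_simps)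
  have "Q (real m * h)" if "m \<le> M" for m
    using that
  proof (induction m)
    case 0
    have "\<forall>\<^sub>F n in sequentially. norm ((complex_of_real 0 *\<^sub>C x) ^ n) = 0"
      using eventually_gt_at_top[of "0 :: nat"] by eventually_elim (simp add: power_0_left)
    then show ?case unfolding Q_def by (simp add: tendsto_eventually)
  next
    case (Suc m)
    have "real m * h \<le> real M * h" using Suc.prems h by (intro mult_right_mono) auto
    then have mR: "real m * h \<le> R" unfolding h_def using M0 by simp
    have m0: "0 \<le> real m * h" using h by simp
    have IH: "Q (real m * h)" using Suc by simp
    have "Q (real m * h + h)"
      by (rule step[OF IH, where s = "real m * h + 2 * h"]) (use m0 mR h h2 in linarith)+
    then show ?case by (simp add: distrib_right add.commute)
  qed
  from this[of M] have "Q R" unfolding h_def using M0 by simp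
  then show ?thesis unfolding Q_def .
qed

text \<open>With \<open>R\<close> at least \<open>norm y\<close>, the powers of \<open>R x\<close>
  tend to 0 while those of \<open>y / R\<close> stay bounded, and their product is \<open>e\<close>.
  Taking a general \<open>e\<close> instead of 1 covers both the whole algebra and a corner.\<close>

lemma eq_0_if_powers_cancel:
  fixes x y e :: "'a::complex_banach_algebra_1"
  assumes unit: "\<And>c. unit_elem (1 - c *\<^sub>C x)" and e: "\<And>n. n > 0 \<Longrightarrow> x ^ n * y ^ n = e"
  shows "e = 0"
proof -
  define R where "R = norm y + 1"
  have R: "R > 0" unfolding R_def by (simp add: add_nonneg_pos)
  have yR: "norm y \<le> R" unfolding R_def by simp
  let ?r = "complex_of_real R" and ?N = "norm (1 :: 'a)"
  have "(\<lambda>n. norm ((?r *\<^sub>C x) ^ n) * ?N) \<longlonglongrightarrow> 0 * ?N"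
    by (intro tendsto_intros scaled_powers_tendsto_0 unit R)
  moreover have "\<forall>\<^sub>F n in sequentially. norm e \<le> norm ((?r *\<^sub>C x) ^ n) * ?N"
    using eventually_gt_at_top[of "0 :: nat"]
  proof eventually_elim
    case (elim n)
    have "(?r *\<^sub>C x) ^ n * (inverse ?r *\<^sub>C y) ^ n = (?r ^ n * inverse ?r ^ n) *\<^sub>C (x ^ n * y ^ n)"
      unfolding scaleC_power by (simp add: mult_scaleC_left mult_scaleC_right scaleC_scaleC mult.commute)
    also have "?r ^ n * inverse ?r ^ n = 1" using R by (simp flip: power_mult_distrib)
    finally have "norm e \<le> norm ((?r *\<^sub>C x) ^ n) * norm ((inverse ?r *\<^sub>C y) ^ n)"
      using norm_mult_ineq[of "(?r *\<^sub>C x) ^ n" "(inverse ?r *\<^sub>C y) ^ n"] e[OF elim] by (simp add: scaleC_one)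
    also have "norm ((inverse ?r *\<^sub>C y) ^ n) \<le> ?N * norm (inverse ?r *\<^sub>C y) ^ n"
      by (rule norm_power_le)
    also have "norm (inverse ?r *\<^sub>C y) \<le> 1"
      using R yR unfolding norm_scaleC norm_inverse by (simp add: field_simps)
    then have "?N * norm (inverse ?r *\<^sub>C y) ^ n \<le> ?N"
      by (simp add: power_le_one mult_left_le)
    finally show ?case by (simp add: mult_left_mono)
  qed
  ultimately have "norm e \<le> 0 * ?N"
    by (intro tendsto_lowerbound) auto
  then show ?thesis by simp
qed

text \<open>An empty spectrum would make \<open>x\<close> and all \<open>1 - c *\<^sub>C x\<close>
  invertible; the powers of \<open>x\<close> and of its inverse cancel to 1, forcing
  \<open>1 = 0\<close>.\<close>

lemma spectrum_nonempty: "spectrum x \<noteq> {}"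
  for x :: "'a::complex_banach_algebra_1"
proof
  assume empty: "spectrum x = {}"
  then have u: "unit_elem (c *\<^sub>C 1 - x)" for c using spectrum_iff[of c x] by simp
  have "unit_elem (1 - c *\<^sub>C x)" for c
  proof (cases "c = 0")
    case True
    then show ?thesis by (simp add: unit_elem_def inverse_of_def)
  next
    case False
    then have "1 - c *\<^sub>C x = c *\<^sub>C (inverse c *\<^sub>C 1 - x)"
      by (simp add: complex_vector.scale_right_diff_distrib scaleC_scaleC scaleC_one)
    then show ?thesis using u False by (simp add: unit_elem_scaleC)
  qed
  moreover obtain q where "inverse_of q (0 *\<^sub>C 1 - x)" using u unfolding unit_elem_def by blast
  then have "x * - q = 1" unfolding inverse_of_def by simp
  then obtain y where xy: "x * y = 1" by blast
  have "x ^ n * y ^ n = 1" for n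
  proof (induction n)
    case (Suc n)
    have "x ^ Suc n * y ^ Suc n = x ^ n * (x * y) * y ^ n"
      unfolding power_Suc2[of x] power_Suc[of y] by (simp only: mult.assoc)
    then show ?case using xy Suc by simp
  qed simp
  ultimately have "(1 :: 'a) = 0" by (rule eq_0_if_powers_cancel)
  then show False by simp
qed

text \<open>If \<open>w\<close> were no multiple of \<open>e\<close>, every
  \<open>e - c *\<^sub>C w\<close> would be nonzero, hence invertible in the corner. Then
  \<open>1 - c *\<^sub>C w\<close> is invertible in the algebra for all \<open>c\<close>, and
  cancelling powers of \<open>w\<close> against its corner inverse gives
  \<open>e = 0\<close>.\<close>

lemma Gelfand_Mazur_corner:
  fixes e w :: "'a::complex_banach_algebra_1"
  assumes e: "e * e = e" "e \<noteq> 0"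
    and div: "\<And>v. e * v * e = v \<Longrightarrow> v \<noteq> 0 \<Longrightarrow> \<exists>y. e * y * e = y \<and> v * y = e \<and> y * v = e"
    and w: "e * w * e = w"
  obtains c where "w = c *\<^sub>C e"
proof (rule ccontr)
  assume "\<not> thesis"
  then have nw: "w \<noteq> c *\<^sub>C e" for c using that by blast
  have corner: "e * v = v \<and> v * e = v" if "e * v * e = v" for v
    using that e(1) by (metis mult.assoc)
  have "unit_elem (1 - c *\<^sub>C w)" for c
  proof -
    let ?v = "e - c *\<^sub>C w"
    have "?v \<noteq> 0"
    proof
      assume *: "?v = 0"
      then have "c \<noteq> 0" using e(2) by auto
      then have "w = inverse c *\<^sub>C (c *\<^sub>C w)" by (simp add: scaleC_scaleC scaleC_one)
      then show False using nw * by simp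
    qed
    moreover have v: "e * ?v * e = ?v"
      using e(1) w by (simp add: left_diff_distrib right_diff_distrib mult_scaleC_left mult_scaleC_right)
    ultimately obtain y where y: "e * y * e = y" "?v * y = e" "y * ?v = e" using div by blast
    \<comment> \<open>Adding \<open>1 - e\<close> extends an inverse in the corner to an inverse in
      the whole algebra.\<close>
    have *: "((1 - e) + v1) * ((1 - e) + v2) = 1"
      if "e * v1 * e = v1" "e * v2 * e = v2" "v1 * v2 = e" for v1 v2
      using that corner[of v1] corner[of v2] e(1) by (simp add: algebra_simps)
    have "inverse_of ((1 - e) + y) ((1 - e) + ?v)"
      unfolding inverse_of_def using *[OF v y(1,2)] *[OF y(1) v y(3)] by simp
    then show ?thesis unfolding unit_elem_def by auto
  qed
  moreover have "w \<noteq> 0" using nw[of 0] by simp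
  then obtain y where y: "e * y * e = y" "w * y = e" using div w by blast
  have "w ^ n * y ^ n = e" if "n > 0" for n
    using that
  proof (induction n rule: nat_induct_non_zero)
    case (Suc n)
    have "e * y ^ n = y ^ n" using corner[OF y(1)] Suc.hyps by (cases n) (simp_all flip: mult.assoc)
    moreover have "w ^ Suc n * y ^ Suc n = w ^ n * ((w * y) * y ^ n)"
      unfolding power_Suc2[of w] power_Suc[of y] by (simp only: mult.assoc)
    ultimately show ?case using y(2) Suc.IH by simp
  qed (simp add: y)
  ultimately have "e = 0" by (rule eq_0_if_powers_cancel)
  then show False using e by simp
qed

section \<open>Minimal idempotents and the socle\<close>

lemma left_idealD:
  assumes "left_ideal I"
  shows "0 \<in> I" "x \<in> I \<Longrightarrow> y \<in> I \<Longrightarrow> x + y \<in> I" "x \<in> I \<Longrightarrow> a * x \<in> I" "x \<in> I \<Longrightarrow> - x \<in> I"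
    "x \<in> I \<Longrightarrow> y \<in> I \<Longrightarrow> x - y \<in> I"
proof -
  show 1: "0 \<in> I" "\<And>x y. x \<in> I \<Longrightarrow> y \<in> I \<Longrightarrow> x + y \<in> I" "\<And>a x. x \<in> I \<Longrightarrow> a * x \<in> I"
    using assms unfolding left_ideal_def by blast+
  show 2: "- x \<in> I" if "x \<in> I" for x using 1(3)[OF that, of "- 1"] by simp
  show "x \<in> I \<Longrightarrow> y \<in> I \<Longrightarrow> x - y \<in> I" using 1(2)[of x "- y"] 2[of y] by simp
qed

lemma left_ideal_add_principal:
  assumes M: "left_ideal M" shows "left_ideal {m + a * x |m a. m \<in> M}"
  unfolding left_ideal_def
proof (intro conjI ballI allI)
  show "0 \<in> {m + a * x |m a. m \<in> M}"
    using left_idealD(1)[OF M] by (intro CollectI exI[of _ 0]) simp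
next
  fix u v assume "u \<in> {m + a * x |m a. m \<in> M}" "v \<in> {m + a * x |m a. m \<in> M}"
  then obtain m a m' a' where "u = m + a * x" "v = m' + a' * x" "m \<in> M" "m' \<in> M" by blast
  then show "u + v \<in> {m + a * x |m a. m \<in> M}"
    using left_idealD(2)[OF M, of m m']
    by (intro CollectI exI[of _ "m + m'"] exI[of _ "a + a'"]) (simp add: algebra_simps)
next
  fix b u assume "u \<in> {m + a * x |m a. m \<in> M}"
  then obtain m a where "u = m + a * x" "m \<in> M" by blast
  then show "b * u \<in> {m + a * x |m a. m \<in> M}"
    using left_idealD(3)[OF M, of m b]
    by (intro CollectI exI[of _ "b * m"] exI[of _ "b * a"]) (simp add: algebra_simps)
qed

lemma left_ideal_principal: "left_ideal {a * x |a. True}" for x :: "'a::ring_1"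
proof -
  have "left_ideal {0 :: 'a}" unfolding left_ideal_def by simp
  from left_ideal_add_principal[OF this, of x] show ?thesis by simp
qed

text \<open>If \<open>x\<close> in \<open>L\<close> missed a maximal left ideal \<open>M\<close>,
  then \<open>1 = m + b * x\<close> with \<open>m\<close> in \<open>M\<close>. As
  \<open>b * x\<close> squares to 0, \<open>1 + b * x\<close> is a left inverse of \<open>m\<close>,
  so \<open>M\<close> contains 1. Hence \<open>x\<close> lies in the radical.\<close>

lemma square_zero_left_ideal_trivial:
  assumes ss: "jacobson_radical = {0 :: 'a::ring_1}" and L: "left_ideal (L :: 'a set)"
    and sq: "\<And>x y. x \<in> L \<Longrightarrow> y \<in> L \<Longrightarrow> x * y = 0"
  shows "L \<subseteq> {0}"
proof
  fix x assume x: "x \<in> L"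
  have "x \<in> M" if M: "maximal_left_ideal M" for M
  proof (rule ccontr)
    assume xM: "x \<notin> M"
    have LM: "left_ideal M" "M \<noteq> UNIV" using M unfolding maximal_left_ideal_def by auto
    let ?I = "{m + a * x |m a. m \<in> M}"
    have "m \<in> ?I" if "m \<in> M" for m
      using that by (intro CollectI exI[of _ m] exI[of _ 0]) simp
    moreover have "x \<in> ?I"
      using left_idealD(1)[OF LM(1)] by (intro CollectI exI[of _ 0] exI[of _ 1]) simp
    ultimately have "?I = UNIV"
      using M left_ideal_add_principal[OF LM(1), of x] xM unfolding maximal_left_ideal_def by blast
    then obtain m b where m: "1 = m + b * x" "m \<in> M" by blast
    have "b * x * (b * x) = 0" using left_idealD(3)[OF L x] by (intro sq)
    moreover have m': "m = 1 - b * x" using m(1) by (metis add_diff_cancel_right')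
    ultimately have "(1 + b * x) * m = 1"
      unfolding m' by (simp add: distrib_right right_diff_distrib)
    then have "1 \<in> M" using left_idealD(3)[OF LM(1) m(2), of "1 + b * x"] by simp
    then have "a \<in> M" for a using left_idealD(3)[OF LM(1), of 1 a] by simp
    then show False using LM(2) by blast
  qed
  then show "x \<in> {0}" using ss unfolding jacobson_radical_def by blast
qed

lemma left_ideal_soc: "left_ideal soc"
  unfolding soc_def left_ideal_def by blast

text \<open>The last conjunct encodes minimality of the left ideal generated by \<open>e\<close>:
  each of its nonzero elements generates \<open>e\<close> again.\<close>

definition minimal_idempotent :: "'a::ring_1 \<Rightarrow> bool" where
  "minimal_idempotent e \<longleftrightarrow> e * e = e \<and> e \<noteq> 0 \<and> (\<forall>b. b * e \<noteq> 0 \<longrightarrow> (\<exists>s. s * (b * e) = e))"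

text \<open>Brauer's lemma. By semisimplicity some \<open>x * y\<close> with \<open>x\<close>,
  \<open>y\<close> in \<open>L\<close> is nonzero, so minimality gives \<open>L y = L\<close> and
  makes right multiplication by \<open>y\<close> injective on \<open>L\<close>. The element
  \<open>e\<close> of \<open>L\<close> with \<open>e * y = y\<close> is then idempotent, since
  \<open>e * e - e\<close> is annihilated by \<open>y\<close>.\<close>

lemma minimal_left_ideal_idempotent:
  assumes ss: "jacobson_radical = {0 :: 'a::ring_1}" and L: "minimal_left_ideal (L :: 'a set)"
  obtains e where "minimal_idempotent e" "L \<subseteq> {a * e |a. True}"
proof -
  have LL: "left_ideal L" "L \<noteq> {0}" and min: "\<And>I. left_ideal I \<Longrightarrow> I \<subseteq> L \<Longrightarrow> I = {0} \<or> I = L"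
    using L unfolding minimal_left_ideal_def by auto
  note D = left_idealD[OF LL(1)]
  have "\<not> L \<subseteq> {0}" using LL(2) D(1) by blast
  then obtain x y where xy: "x \<in> L" "y \<in> L" "x * y \<noteq> 0"
    using square_zero_left_ideal_trivial[OF ss LL(1)] by blast
  have gen: "L = {a * v |a. True}" if "v \<in> L" "v \<noteq> 0" for v
  proof -
    have "{a * v |a. True} \<subseteq> L" using D(3) that by blast
    moreover have "v \<in> {a * v |a. True}" by (intro CollectI exI[of _ 1]) simp
    ultimately show ?thesis using min[OF left_ideal_principal, of v] that by blast
  qed
  have "left_ideal {w * y |w. w \<in> L}"
    unfolding left_ideal_def
  proof (intro conjI ballI allI)
    show "0 \<in> {w * y |w. w \<in> L}" using D(1) by (intro CollectI exI[of _ 0]) simp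
    show "u + v \<in> {w * y |w. w \<in> L}" if "u \<in> {w * y |w. w \<in> L}" "v \<in> {w * y |w. w \<in> L}" for u v
      using that D(2) by (force simp flip: distrib_right)
    show "a * u \<in> {w * y |w. w \<in> L}" if "u \<in> {w * y |w. w \<in> L}" for a u
      using that D(3) by (force simp flip: mult.assoc)
  qed
  moreover have "{w * y |w. w \<in> L} \<subseteq> L" using D(3) xy(2) by blast
  moreover have "x * y \<in> {w * y |w. w \<in> L}" using xy by blast
  ultimately have "{w * y |w. w \<in> L} = L" using min xy(3) by blast
  then have "y \<in> {w * y |w. w \<in> L}" using xy(2) by simp
  then obtain e where "e \<in> L" "y = e * y" by blast
  then have e: "e \<in> L" "e * y = y" by simp_all
  have "left_ideal {w \<in> L. w * y = 0}"
    using D unfolding left_ideal_def by (auto simp: distrib_right mult.assoc)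
  moreover have "x \<notin> {w \<in> L. w * y = 0}" using xy by simp
  ultimately have "{w \<in> L. w * y = 0} = {0}" using min[of "{w \<in> L. w * y = 0}"] xy(1) by blast
  moreover have "e * e - e \<in> {w \<in> L. w * y = 0}" using e D(3,5) by (simp add: left_diff_distrib mult.assoc)
  ultimately have "e * e - e = 0" by blast
  then have ee: "e * e = e" by simp
  have e0: "e \<noteq> 0" using e xy(3) by auto
  have "\<exists>s. s * (b * e) = e" if "b * e \<noteq> 0" for b
  proof -
    have "e \<in> {a * (b * e) |a. True}" using gen[OF D(3)[OF e(1)] that] e(1) by blast
    then obtain s where "e = s * (b * e)" by blast
    then show ?thesis by (intro exI[of _ s]) (rule sym)
  qed
  then have "minimal_idempotent e" unfolding minimal_idempotent_def using ee e0 by blast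
  moreover have "L \<subseteq> {a * e |a. True}" using gen[OF e(1) e0] by blast
  ultimately show thesis by (rule that)
qed

text \<open>Sums of this form constitute a left ideal that contains all minimal left ideals, hence
  the socle.\<close>

lemma soc_decomposition:
  assumes ss: "jacobson_radical = {0 :: 'a::ring_1}" and a: "(a :: 'a) \<in> soc"
  obtains E u where "finite E" "\<And>e. e \<in> E \<Longrightarrow> minimal_idempotent e" "a = (\<Sum>e\<in>E. u e * e)"
proof -
  define S :: "'a set" where
    "S = {\<Sum>e\<in>E. u e * e |E u. finite E \<and> (\<forall>e\<in>E. minimal_idempotent e)}"
  have "left_ideal S"
    unfolding left_ideal_def
  proof (intro conjI ballI allI)
    show "0 \<in> S" unfolding S_def by (intro CollectI exI[of _ "{}"]) simp
  next
    fix x y assume "x \<in> S" "y \<in> S"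
    then obtain E u E' u' where E: "finite E" "\<forall>e\<in>E. minimal_idempotent e" "x = (\<Sum>e\<in>E. u e * e)"
      and E': "finite E'" "\<forall>e\<in>E'. minimal_idempotent e" "y = (\<Sum>e\<in>E'. u' e * e)"
      unfolding S_def by blast
    \<comment> \<open>An idempotent may occur in both sums, so the coefficients are added
      there.\<close>
    define v where "v e = (if e \<in> E then u e else 0) + (if e \<in> E' then u' e else 0)" for e
    have "(\<Sum>e\<in>E \<union> E'. v e * e)
        = (\<Sum>e\<in>E \<union> E'. if e \<in> E then u e * e else 0) + (\<Sum>e\<in>E \<union> E'. if e \<in> E' then u' e * e else 0)"
      unfolding v_def sum.distrib[symmetric] by (intro sum.cong) (auto simp: distrib_right)
    also have "(\<Sum>e\<in>E \<union> E'. if e \<in> E then u e * e else 0) = x"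
      unfolding E(3) using E(1) E'(1) by (intro sum.mono_neutral_cong_right) auto
    also have "(\<Sum>e\<in>E \<union> E'. if e \<in> E' then u' e * e else 0) = y"
      unfolding E'(3) using E(1) E'(1) by (intro sum.mono_neutral_cong_right) auto
    finally show "x + y \<in> S"
      unfolding S_def using E E' by (intro CollectI exI[of _ "E \<union> E'"] exI[of _ v]) auto
  next
    fix b x assume "x \<in> S"
    then obtain E u where E: "finite E" "\<forall>e\<in>E. minimal_idempotent e" "x = (\<Sum>e\<in>E. u e * e)"
      unfolding S_def by blast
    then show "b * x \<in> S"
      unfolding S_def
      by (intro CollectI exI[of _ E] exI[of _ "\<lambda>e. b * u e"]) (simp add: sum_distrib_left mult.assoc)
  qed
  moreover have "L \<subseteq> S" if L: "minimal_left_ideal L" for L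
  proof -
    obtain e where e: "minimal_idempotent e" "L \<subseteq> {a * e |a. True}"
      using minimal_left_ideal_idempotent[OF ss L] .
    have "b * e \<in> S" for b
      unfolding S_def using e(1) by (intro CollectI exI[of _ "{e}"] exI[of _ "\<lambda>_. b"]) simp
    then show ?thesis using e(2) by blast
  qed
  ultimately have "a \<in> S" using a unfolding soc_def by blast
  then show thesis unfolding S_def using that by blast
qed

text \<open>Minimality gives each nonzero element \<open>v\<close> of the corner a left inverse
  \<open>y\<close> there. Now \<open>y\<close> is nonzero and has a left inverse too, which must
  equal \<open>v\<close>; so the corner is a division algebra and Gelfand-Mazur applies.\<close>

lemma minimal_idempotent_corner:
  fixes e :: "'a::complex_banach_algebra_1"
  assumes e: "minimal_idempotent e"
  obtains c where "e * w * e = c *\<^sub>C e"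
proof (rule Gelfand_Mazur_corner)
  have ee: "e * e = e" and min: "\<And>b. b * e \<noteq> 0 \<Longrightarrow> \<exists>s. s * (b * e) = e"
    using e unfolding minimal_idempotent_def by blast+
  then show "e * e = e" "e \<noteq> 0" using e unfolding minimal_idempotent_def by blast+
  show "e * (e * w * e) * e = e * w * e" using ee by (metis mult.assoc)
  fix v assume v: "e * v * e = v" "v \<noteq> 0"
  have inv: "\<exists>y. e * y * e = y \<and> y * v = e" if v: "e * v * e = v" "v \<noteq> 0" for v
  proof -
    have ve: "v * e = v" "e * v = v" using v(1) ee by (metis mult.assoc)+
    then obtain s where s: "s * v = e" using min[of v] v(2) by auto
    have "e * (e * s * e) * e = e * s * e" using ee by (metis mult.assoc)
    moreover have "e * s * e * v = e" using ve s ee by (metis mult.assoc)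
    ultimately show ?thesis by blast
  qed
  obtain y where y: "e * y * e = y" "y * v = e" using inv[OF v] by blast
  have "y \<noteq> 0" using y(2) \<open>e \<noteq> 0\<close> by auto
  then obtain y' where y': "e * y' * e = y'" "y' * y = e" using inv[OF y(1)] by blast
  have "y' = y' * (y * v)" using y' y(2) ee by (metis mult.assoc)
  also have "\<dots> = v" using y' v(1) ee by (metis mult.assoc)
  finally show "\<exists>y. e * y * e = y \<and> v * y = e \<and> y * v = e" using y y' by blast
qed (rule that)

text \<open>Fix a nonzero \<open>v = e * w0 * f\<close> and, by minimality of \<open>f\<close>, some
  \<open>s\<close> with \<open>s * v = f\<close>. Then \<open>e * w * f\<close> equals
  \<open>e * (w * s) * e * v\<close>, and the corner of \<open>e\<close> consists of scalar
  multiples of \<open>e\<close>. The scalar is the functional; if no such \<open>v\<close> exists,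
  zero serves.\<close>

lemma minimal_idempotents_functional:
  fixes e f :: "'a::complex_banach_algebra_1"
  assumes e: "minimal_idempotent e" and f: "minimal_idempotent f"
  obtains \<phi> v where "cfunctional \<phi>" "v * f = v" "\<And>w. e * w * f = \<phi> w *\<^sub>C v"
proof (cases "\<forall>w. e * w * f = 0")
  case True
  show ?thesis
    by (rule that[of "\<lambda>_. 0" 0]) (use True in \<open>auto simp: cfunctional_def bounded_linear_zero\<close>)
next
  case False
  then obtain w0 where w0: "e * w0 * f \<noteq> 0" by blast
  define v where "v = e * w0 * f"
  have v0: "v \<noteq> 0" using w0 v_def by simp
  have ff: "f * f = f" and min: "\<And>b. b * f \<noteq> 0 \<Longrightarrow> \<exists>s. s * (b * f) = f"
    using f unfolding minimal_idempotent_def by blast+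
  have ee: "e * e = e" using e unfolding minimal_idempotent_def by blast
  have ev: "e * v = v" "v * f = v" unfolding v_def using ee ff by (metis mult.assoc)+
  obtain s where s: "s * v = f" using min[OF w0] unfolding v_def by blast
  have "\<exists>c. e * w * f = c *\<^sub>C v" for w
  proof -
    obtain c where c: "e * (w * s) * e = c *\<^sub>C e" using minimal_idempotent_corner[OF e] .
    have "e * w * f = e * (w * s) * e * v" using s ev by (metis mult.assoc)
    also have "\<dots> = c *\<^sub>C v" unfolding c using ev by (simp add: mult_scaleC_left)
    finally show ?thesis by blast
  qed
  then obtain \<phi> where \<phi>: "\<And>w. e * w * f = \<phi> w *\<^sub>C v" by metis
  have uniq: "c = d" if "c *\<^sub>C v = d *\<^sub>C v" for c d
    using that v0 by simp
  have add: "\<phi> (x + y) = \<phi> x + \<phi> y" for x y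
    by (rule uniq) (simp add: scaleC_add_left distrib_left distrib_right flip: \<phi>)
  have hom: "\<phi> (c *\<^sub>C x) = c * \<phi> x" for c x
    by (rule uniq) (simp add: mult_scaleC_left mult_scaleC_right flip: \<phi> scaleC_scaleC)
  have "bounded_linear \<phi>"
  proof (rule bounded_linear_intro)
    show "\<phi> (r *\<^sub>R x) = r *\<^sub>R \<phi> x" for r x
      unfolding scaleR_scaleC hom by (simp add: scaleR_conv_of_real)
    fix x
    have "cmod (\<phi> x) * norm v = norm (e * x * f)" unfolding \<phi> by (simp add: norm_scaleC)
    also have "\<dots> \<le> norm e * norm x * norm f"
      by (meson norm_mult_ineq mult_right_mono norm_ge_zero order_trans)
    finally show "norm (\<phi> x) \<le> norm x * (norm e * norm f / norm v)"
      using v0 by (simp add: field_simps)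
  qed (rule add)
  then have "cfunctional \<phi>" unfolding cfunctional_def using hom by blast
  then show thesis by (rule that[OF _ ev(2) \<phi>])
qed

text \<open>Multiplying the rank-one formula for each pair of idempotents by the coefficient
  \<open>u i\<close> and summing over \<open>i\<close> gives the last claim: for fixed
  \<open>j\<close> all \<open>a * w * e j\<close> lie in the span of finitely many
  \<open>g i j\<close>.\<close>

lemma soc_finite_rank:
  fixes a :: "'a::complex_banach_algebra_1"
  assumes ss: "jacobson_radical = {0 :: 'a}" and a: "a \<in> soc"
  obtains n :: nat and u e :: "nat \<Rightarrow> 'a" and \<phi> :: "nat \<Rightarrow> nat \<Rightarrow> 'a \<Rightarrow> complex"
    and g :: "nat \<Rightarrow> nat \<Rightarrow> 'a"
  where "a = (\<Sum>j<n. u j * e j)" "\<And>j. j < n \<Longrightarrow> e j * e j = e j"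
    "\<And>i j. cfunctional (\<phi> i j)" "\<And>i j. j < n \<Longrightarrow> g i j * e j = g i j"
    "\<And>w j. j < n \<Longrightarrow> a * w * e j = (\<Sum>i<n. \<phi> i j w *\<^sub>C g i j)"
proof -
  obtain E u where E: "finite E" "\<And>e. e \<in> E \<Longrightarrow> minimal_idempotent e" "a = (\<Sum>e\<in>E. u e * e)"
    using soc_decomposition[OF ss a] by blast
  obtain ix where ix: "bij_betw ix {..<card E} E"
    using ex_bij_betw_nat_finite[OF E(1)] by (auto simp: atLeast0LessThan)
  have ixE: "ix j \<in> E" if "j < card E" for j using ix that by (auto simp: bij_betw_def)
  have asum: "a = (\<Sum>j<card E. u (ix j) * ix j)"
    unfolding E(3) by (rule sum.reindex_bij_betw[OF ix, symmetric])
  define good where "good e f \<phi> v \<longleftrightarrow> cfunctional \<phi> \<and> v * f = v \<and> (\<forall>w. e * w * f = \<phi> w *\<^sub>C v)"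
    for e f v :: 'a and \<phi>
  have "\<exists>\<phi> v. good e f \<phi> v" if "e \<in> E" "f \<in> E" for e f
    using minimal_idempotents_functional[OF E(2)[OF that(1)] E(2)[OF that(2)]] unfolding good_def by metis
  then obtain \<Phi> V where good: "\<And>e f. e \<in> E \<Longrightarrow> f \<in> E \<Longrightarrow> good e f (\<Phi> e f) (V e f)" by metis
  \<comment> \<open>The zero default outside the index range makes every \<open>\<phi> i j\<close> a
    bounded complex functional.\<close>
  define \<phi> where "\<phi> i j = (if i < card E \<and> j < card E then \<Phi> (ix i) (ix j) else (\<lambda>_. 0))" for i j
  define g where "g i j = (if i < card E \<and> j < card E then u (ix i) * V (ix i) (ix j) else 0)" for i j
  show thesis
  proof (rule that[of "\<lambda>j. u (ix j)" ix "card E" \<phi> g])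
    show "ix j * ix j = ix j" if "j < card E" for j
      using E(2)[OF ixE[OF that]] unfolding minimal_idempotent_def by blast
    show "cfunctional (\<phi> i j)" for i j
      using good[OF ixE ixE, of i j] unfolding \<phi>_def good_def
      by (auto simp: cfunctional_def bounded_linear_zero)
    show "g i j * ix j = g i j" if "j < card E" for i j
      using good[OF ixE ixE, of i j] that unfolding g_def good_def by (simp add: mult.assoc)
    show "a * w * ix j = (\<Sum>i<card E. \<phi> i j w *\<^sub>C g i j)" if j: "j < card E" for w j
    proof -
      have "u (ix i) * ix i * w * ix j = \<phi> i j w *\<^sub>C g i j" if i: "i < card E" for i
      proof -
        have "u (ix i) * ix i * w * ix j = u (ix i) * (ix i * w * ix j)" by (simp add: mult.assoc)
        also have "ix i * w * ix j = \<Phi> (ix i) (ix j) w *\<^sub>C V (ix i) (ix j)"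
          using good[OF ixE ixE, OF i j] unfolding good_def by blast
        finally show ?thesis unfolding \<phi>_def g_def using i j by (simp add: mult_scaleC_right)
      qed
      then show ?thesis by (subst asum) (simp add: sum_distrib_right)
    qed
  qed (rule asum)
qed

section \<open>Determinants of \<open>1 - l A\<close>\<close>

no_notation Finite_Cartesian_Product.vec_nth (infixl \<open>$\<close> 90)
notation Matrix.vec_index (infixl \<open>$v\<close> 100)

definition fredholm_det :: "nat \<Rightarrow> (nat \<Rightarrow> nat \<Rightarrow> complex) \<Rightarrow> complex \<Rightarrow> complex" where
  "fredholm_det n A l = Determinant.det (mat n n (\<lambda>(i, k). (if i = k then 1 else 0) - l * A i k))"

section \<open>Kernel vectors and solvability\<close>

lemma mat_mult_vec_eq_0_iff:
  fixes A :: "nat \<Rightarrow> nat \<Rightarrow> complex"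
  shows "mat n n (\<lambda>(i, k). (if i = k then 1 else 0) - l * A i k) *\<^sub>v vec n c = 0\<^sub>v n
    \<longleftrightarrow> (\<forall>i<n. c i = l * (\<Sum>k<n. A i k * c k))"
    (is "?M *\<^sub>v _ = _ \<longleftrightarrow> _")
proof -
  have "(\<Sum>k = 0..<n. ((if i = k then 1 else 0) - l * A i k) * c k)
      = c i - l * (\<Sum>k<n. A i k * c k)" if "i < n" for i
  proof -
    have "(\<Sum>k = 0..<n. ((if i = k then 1 else 0) - l * A i k) * c k)
      = (\<Sum>k = 0..<n. (if i = k then c k else 0)) - (\<Sum>k = 0..<n. l * A i k * c k)"
      unfolding sum_subtractf[symmetric] by (rule sum.cong) (auto simp: algebra_simps)
    then show ?thesis
      using that by (simp add: sum.delta' sum_distrib_left atLeast0LessThan mult.assoc)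
  qed
  then have entry: "(?M *\<^sub>v vec n c) $v i = c i - l * (\<Sum>k<n. A i k * c k)" if "i < n" for i
    using that by (simp add: scalar_prod_def)
  show ?thesis
  proof
    assume "?M *\<^sub>v vec n c = 0\<^sub>v n"
    then have "c i - l * (\<Sum>k<n. A i k * c k) = 0" if "i < n" for i
      using entry[OF that] that by simp
    then show "\<forall>i<n. c i = l * (\<Sum>k<n. A i k * c k)" by simp
  next
    assume "\<forall>i<n. c i = l * (\<Sum>k<n. A i k * c k)"
    then have "(?M *\<^sub>v vec n c) $v i = 0" if "i < n" for i
      using entry[OF that] that by simp
    then show "?M *\<^sub>v vec n c = 0\<^sub>v n" by (intro eq_vecI) auto
  qed
qed

lemma vec_eq_zero_vec_iff: "vec n c = 0\<^sub>v n \<longleftrightarrow> (\<forall>i<n. c i = 0)"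
proof
  assume "vec n c = 0\<^sub>v n"
  then show "\<forall>i<n. c i = 0" by (metis index_vec index_zero_vec(1))
qed (auto intro!: eq_vecI)

lemma fredholm_det_eq_0_iff:
  "fredholm_det n A l = 0 \<longleftrightarrow>
     (\<exists>c. (\<exists>i<n. c i \<noteq> 0) \<and> (\<forall>i<n. c i = l * (\<Sum>k<n. A i k * c k)))"
    (is "_ \<longleftrightarrow> ?R")
proof -
  let ?M = "mat n n (\<lambda>(i, k). (if i = k then 1 else 0) - l * A i k)"
  have "fredholm_det n A l = 0 \<longleftrightarrow> (\<exists>v. v \<in> carrier_vec n \<and> v \<noteq> 0\<^sub>v n \<and> ?M *\<^sub>v v = 0\<^sub>v n)"
    unfolding fredholm_det_def by (rule det_0_iff_vec_prod_zero) simp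
  also have "\<dots> \<longleftrightarrow> (\<exists>c. vec n c \<noteq> 0\<^sub>v n \<and> ?M *\<^sub>v vec n c = 0\<^sub>v n)"
  proof
    assume "\<exists>v. v \<in> carrier_vec n \<and> v \<noteq> 0\<^sub>v n \<and> ?M *\<^sub>v v = 0\<^sub>v n"
    then obtain v where v: "v \<in> carrier_vec n" "v \<noteq> 0\<^sub>v n" "?M *\<^sub>v v = 0\<^sub>v n" by blast
    have "vec n (\<lambda>i. v $v i) = v" using v(1) by auto
    with v(2,3) show "\<exists>c. vec n c \<noteq> 0\<^sub>v n \<and> ?M *\<^sub>v vec n c = 0\<^sub>v n"
      by (intro exI[of _ "\<lambda>i. v $v i"]) (simp only:, simp)
  next
    assume "\<exists>c. vec n c \<noteq> 0\<^sub>v n \<and> ?M *\<^sub>v vec n c = 0\<^sub>v n"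
    then obtain c where "vec n c \<noteq> 0\<^sub>v n" "?M *\<^sub>v vec n c = 0\<^sub>v n" by blast
    then show "\<exists>v. v \<in> carrier_vec n \<and> v \<noteq> 0\<^sub>v n \<and> ?M *\<^sub>v v = 0\<^sub>v n"
      by (intro exI[of _ "vec n c"] conjI vec_carrier)
  qed
  also have "\<dots> \<longleftrightarrow> ?R"
    unfolding mat_mult_vec_eq_0_iff vec_eq_zero_vec_iff by blast
  finally show ?thesis .
qed

text \<open>Needed to construct an inverse of \<open>1 - l *\<^sub>C (a * r)\<close>, whereas the
  kernel criterion alone yields injectivity.\<close>

lemma fredholm_det_solve:
  assumes "fredholm_det n A l \<noteq> 0"
  obtains c where "\<And>i. i < n \<Longrightarrow> c i = b i + l * (\<Sum>k<n. A i k * c k)"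
proof -
  let ?M = "mat n n (\<lambda>(i, k). (if i = k then 1 else 0) - l * A i k)"
  have M: "?M \<in> carrier_mat n n" by simp
  from det_non_zero_imp_unit[OF M, of "()"] assms
  obtain B where B: "B \<in> carrier_mat n n" and MB: "?M * B = 1\<^sub>m n"
    unfolding Units_def ring_mat_def fredholm_det_def by auto
  define v where "v = B *\<^sub>v vec n b"
  have v: "v \<in> carrier_vec n" unfolding v_def using B by simp
  have "?M *\<^sub>v v = (?M * B) *\<^sub>v vec n b"
    unfolding v_def by (rule assoc_mult_mat_vec[symmetric, OF M B]) simp
  then have Mv: "?M *\<^sub>v v = vec n b" unfolding MB by simp
  have "v $v i = b i + l * (\<Sum>k<n. A i k * v $v k)" if i: "i < n" for i
  proof -
    have "(\<Sum>k = 0..<n. ((if i = k then 1 else 0) - l * A i k) * v $v k) = (?M *\<^sub>v v) $v i"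
      using i v by (auto simp: scalar_prod_def)
    also have "\<dots> = b i" unfolding Mv using i by simp
    finally have "b i = (\<Sum>k = 0..<n. ((if i = k then 1 else 0) - l * A i k) * v $v k)" by simp
    also have "\<dots> = (\<Sum>k = 0..<n. (if i = k then v $v k else 0)) - (\<Sum>k = 0..<n. l * A i k * v $v k)"
      unfolding sum_subtractf[symmetric] by (rule sum.cong) (auto simp: algebra_simps)
    finally show ?thesis
      using i by (simp add: sum.delta' sum_distrib_left atLeast0LessThan mult.assoc)
  qed
  then show ?thesis by (rule that)
qed

section \<open>Dependence of the determinant on the matrix and on \<open>l\<close>\<close>

lemma fredholm_det_0: "fredholm_det n A 0 = 1"
proof -
  have "mat n n (\<lambda>(i, k). (if i = k then 1 else 0) - 0 * A i k) = 1\<^sub>m n"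
    by (rule eq_matI) auto
  then show ?thesis unfolding fredholm_det_def by simp
qed

lemma fredholm_det_Leibniz:
  "fredholm_det n A l = (\<Sum>p | p permutes {0..<n}. signof p *
     (\<Prod>i=0..<n. (if i = p i then 1 else 0) - l * A i (p i)))"
proof -
  have "p i < n" if "p permutes {0..<n}" "i < n" for p i
    using permutes_in_image[OF that(1), of i] that(2) by simp
  then show ?thesis
    unfolding fredholm_det_def
    by (subst det_def'[of _ n]) (auto intro!: sum.cong prod.cong)
qed

lemma holomorphic_on_fredholm_det:
  assumes "\<And>i k. i < n \<Longrightarrow> k < n \<Longrightarrow> (\<lambda>z. A z i k) holomorphic_on U"
  shows "(\<lambda>z. fredholm_det n (A z) l) holomorphic_on U"
proof -
  have "p i < n" if "p permutes {0..<n}" "i < n" for p i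
    using permutes_in_image[OF that(1), of i] that(2) by simp
  then show ?thesis
    unfolding fredholm_det_Leibniz
    by (intro holomorphic_intros assms) auto
qed

text \<open>The common degree bound turns evaluation into a sum of fixed length with continuous
  coefficients, hence jointly continuous in the point and the variable.\<close>

definition continuous_poly_family :: "complex set \<Rightarrow> (complex \<Rightarrow> complex poly) \<Rightarrow> bool" where
  "continuous_poly_family U P \<longleftrightarrow>
     (\<forall>k. continuous_on U (\<lambda>z. poly.coeff (P z) k)) \<and> (\<exists>N. \<forall>z. degree (P z) \<le> N)"

lemma continuous_poly_family_const: "continuous_poly_family U (\<lambda>z. c)"
  unfolding continuous_poly_family_def by auto

lemma continuous_poly_family_linear:
  assumes "continuous_on U f" "continuous_on U g"
  shows "continuous_poly_family U (\<lambda>z. [:f z, g z:])"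
proof -
  have "continuous_on U (\<lambda>z. poly.coeff [:f z, g z:] k)" for k
    using assms by (cases k; cases "k - 1") auto
  moreover have "degree [:f z, g z:] \<le> 1" for z by simp
  ultimately show ?thesis unfolding continuous_poly_family_def by blast
qed

lemma continuous_poly_family_add:
  assumes "continuous_poly_family U P" "continuous_poly_family U Q"
  shows "continuous_poly_family U (\<lambda>z. P z + Q z)"
proof -
  obtain M N where "\<And>z. degree (P z) \<le> M" "\<And>z. degree (Q z) \<le> N"
    using assms unfolding continuous_poly_family_def by blast
  then have "degree (P z + Q z) \<le> max M N" for z
    by (meson degree_add_le max.cobounded1 max.cobounded2 order_trans)
  then show ?thesis
    using assms unfolding continuous_poly_family_def
    by (auto intro!: continuous_on_add)
qed

lemma continuous_poly_family_mult:
  assumes "continuous_poly_family U P" "continuous_poly_family U Q"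
  shows "continuous_poly_family U (\<lambda>z. P z * Q z)"
proof -
  obtain M N where "\<And>z. degree (P z) \<le> M" "\<And>z. degree (Q z) \<le> N"
    using assms unfolding continuous_poly_family_def by blast
  then have "degree (P z * Q z) \<le> M + N" for z
    by (meson degree_mult_le add_mono order_trans)
  then show ?thesis
    using assms unfolding continuous_poly_family_def
    by (auto simp: coeff_mult intro!: continuous_on_sum continuous_on_mult)
qed

lemma continuous_poly_family_sum:
  assumes "\<And>i. i \<in> I \<Longrightarrow> continuous_poly_family U (P i)"
  shows "continuous_poly_family U (\<lambda>z. \<Sum>i\<in>I. P i z)"
  using assms
  by (induction I rule: infinite_finite_induct)
    (auto intro: continuous_poly_family_const continuous_poly_family_add)

lemma continuous_poly_family_prod:
  assumes "\<And>i. i \<in> I \<Longrightarrow> continuous_poly_family U (P i)"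
  shows "continuous_poly_family U (\<lambda>z. \<Prod>i\<in>I. P i z)"
  using assms
  by (induction I rule: infinite_finite_induct)
    (auto intro: continuous_poly_family_const continuous_poly_family_mult)

text \<open>The variable is \<open>s = l - 1\<close> because the behaviour near \<open>l = 1\<close>
  matters. Each entry of the matrix is affine in \<open>s\<close>, and the Leibniz formula
  multiplies and adds such entries.\<close>

lemma fredholm_det_poly_family:
  assumes "\<And>i k. i < n \<Longrightarrow> k < n \<Longrightarrow> continuous_on U (\<lambda>z. A z i k)"
  obtains P where "continuous_poly_family U P" "\<And>z s. poly (P z) s = fredholm_det n (A z) (1 + s)"
proof
  let ?P = "\<lambda>z. \<Sum>p | p permutes {0..<n}. [:signof p:] *
     (\<Prod>i=0..<n. [:(if i = p i then 1 else 0) - A z i (p i), - A z i (p i):])"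
  have "p i < n" if "p permutes {0..<n}" "i < n" for p i
    using permutes_in_image[OF that(1), of i] that(2) by simp
  then show "continuous_poly_family U ?P"
    by (intro continuous_poly_family_sum continuous_poly_family_mult continuous_poly_family_prod
        continuous_poly_family_const continuous_poly_family_linear continuous_intros assms) auto
  show "poly (?P z) s = fredholm_det n (A z) (1 + s)" for z s
    unfolding fredholm_det_Leibniz poly_sum poly_mult poly_prod
    by (intro sum.cong prod.cong arg_cong2[where f = "(*)"]) (auto simp: algebra_simps)
qed

text \<open>The witness is a point where the lowest coefficient that is not identically zero on \<open>U\<close>
  does not vanish; dividing by the corresponding power of \<open>s\<close> gives a function that is continuous
  and nonzero at \<open>(z, 0)\<close>.\<close>

lemma poly_family_nonzero_near_0:
  assumes P: "continuous_poly_family U P" and U: "open U"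
    and nz: "z1 \<in> U" "P z1 \<noteq> 0"
  obtains z r where "z \<in> U" "r > 0"
    "\<And>w s. dist w z < r \<Longrightarrow> 0 < cmod s \<Longrightarrow> cmod s < r \<Longrightarrow> w \<in> U \<and> poly (P w) s \<noteq> 0"
proof -
  define k where "k = (LEAST k. \<exists>z\<in>U. poly.coeff (P z) k \<noteq> 0)"
  have ex: "\<exists>k. \<exists>z\<in>U. poly.coeff (P z) k \<noteq> 0"
    using nz by (auto simp: poly_eq_iff)
  have "\<exists>z\<in>U. poly.coeff (P z) k \<noteq> 0" unfolding k_def by (rule LeastI_ex[OF ex])
  then obtain z where z: "z \<in> U" "poly.coeff (P z) k \<noteq> 0" by blast
  have low: "poly.coeff (P w) j = 0" if "w \<in> U" "j < k" for w j
    using not_less_Least[of j "\<lambda>k. \<exists>z\<in>U. poly.coeff (P z) k \<noteq> 0"] that unfolding k_def by blast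
  obtain N where N: "\<And>z. degree (P z) \<le> N" using P unfolding continuous_poly_family_def by blast
  \<comment> \<open>On \<open>U\<close> this is the quotient of \<open>poly (P w) s\<close> by
    \<open>s ^ k\<close>, extended continuously to \<open>s = 0\<close>.\<close>
  define E where "E = (\<lambda>(w, s). \<Sum>j\<le>N. poly.coeff (P w) (j + k) * s ^ j)"
  have PE: "poly (P w) s = s ^ k * E (w, s)" if "w \<in> U" for w s
  proof -
    have "poly (P w) s = (\<Sum>j\<le>N + k. poly.coeff (P w) j * s ^ j)"
      using N[of w] unfolding poly_altdef
      by (intro sum.mono_neutral_left) (auto simp: coeff_eq_0)
    also have "\<dots> = (\<Sum>j\<in>{k..N + k}. poly.coeff (P w) j * s ^ j)"
      using low[OF that] by (intro sum.mono_neutral_right) auto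
    also have "\<dots> = (\<Sum>j\<in>{0..N}. poly.coeff (P w) (j + k) * s ^ (j + k))"
      using sum.shift_bounds_cl_nat_ivl[of "\<lambda>j. poly.coeff (P w) j * s ^ j" 0 k N] by simp
    finally show ?thesis
      unfolding E_def by (simp add: sum_distrib_left power_add atLeast0AtMost algebra_simps)
  qed
  have cont: "continuous_on (U \<times> UNIV) E"
    unfolding E_def case_prod_beta
    using P unfolding continuous_poly_family_def
    by (intro continuous_intros) (auto intro!: continuous_on_compose2[OF _ continuous_on_fst])
  have op: "open (U \<times> (UNIV :: complex set))" using U by (intro open_Times) auto
  have "E (z, 0) = poly.coeff (P z) k"
    unfolding E_def by (simp add: power_0_left if_distrib cong: if_cong)
  then have E0: "E (z, 0) \<noteq> 0" using z by simp
  have "open ((U \<times> UNIV) \<inter> E -` (- {0}))"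
    using cont op by (intro continuous_open_preimage) auto
  moreover have "(z, 0) \<in> (U \<times> UNIV) \<inter> E -` (- {0})" using E0 z by auto
  ultimately obtain A B where AB: "open A" "open B" "z \<in> A" "0 \<in> B"
    "A \<times> B \<subseteq> (U \<times> UNIV) \<inter> E -` (- {0})"
    by (rule open_prod_elim) auto
  obtain r1 where r1: "r1 > 0" "ball z r1 \<subseteq> A" using AB open_contains_ball by blast
  obtain r2 where r2: "r2 > 0" "ball 0 r2 \<subseteq> B" using AB open_contains_ball by blast
  show ?thesis
  proof (rule that[OF z(1), of "min r1 r2"])
    show "min r1 r2 > 0" using r1 r2 by simp
    fix w s assume ws: "dist w z < min r1 r2" "0 < cmod s" "cmod s < min r1 r2"
    then have "w \<in> A" "s \<in> B" using r1 r2 by (auto simp: dist_commute subset_iff)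
    then have "(w, s) \<in> (U \<times> UNIV) \<inter> E -` (- {0})" using AB by blast
    then show "w \<in> U \<and> poly (P w) s \<noteq> 0" using PE[of w s] ws by auto
  qed
qed

section \<open>Perturbation by elements of the socle\<close>

text \<open>Left multiplication by \<open>a r\<close> maps the left ideal \<open>A e\<^sub>j\<close> into the span of the \<open>g i j\<close>, and
  its matrix there is \<open>\<phi> i j (r g k j)\<close>. Injectivity of \<open>1 - l a r\<close> on all these ideals already
  gives a two-sided inverse, because \<open>a\<close> lies in their sum.\<close>

lemma unit_elem_iff_fredholm_det:
  fixes a r :: "'a::complex_banach_algebra_1"
  assumes a: "a = (\<Sum>j<n. u j * e j)" and e: "\<And>j. j < n \<Longrightarrow> e j * e j = e j"
    and \<phi>: "\<And>i j. cfunctional (\<phi> i j)" and g: "\<And>i j. j < n \<Longrightarrow> g i j * e j = g i j"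
    and rank: "\<And>w j. j < n \<Longrightarrow> a * w * e j = (\<Sum>i<n. \<phi> i j w *\<^sub>C g i j)"
  shows "unit_elem (1 - l *\<^sub>C (a * r)) \<longleftrightarrow>
    (\<forall>j<n. fredholm_det n (\<lambda>i k. \<phi> i j (r * g k j)) l \<noteq> 0)"
proof
  have lin: "\<phi> i j (x + y) = \<phi> i j x + \<phi> i j y" "\<phi> i j (c *\<^sub>C x) = c * \<phi> i j x" "\<phi> i j 0 = 0"
    "\<phi> i j (sum h I) = (\<Sum>k\<in>I. \<phi> i j (h k))" for i j x y c and h :: "nat \<Rightarrow> 'a" and I
  proof -
    interpret bounded_linear "\<phi> i j" using \<phi> unfolding cfunctional_def by simp
    show "\<phi> i j (x + y) = \<phi> i j x + \<phi> i j y" "\<phi> i j 0 = 0"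
      "\<phi> i j (sum h I) = (\<Sum>k\<in>I. \<phi> i j (h k))" by (rule add zero sum)+
    show "\<phi> i j (c *\<^sub>C x) = c * \<phi> i j x" using \<phi> unfolding cfunctional_def by simp
  qed
  have lincomb: "\<phi> i j (r * (\<Sum>k<n. \<gamma> k *\<^sub>C g k j)) = (\<Sum>k<n. \<phi> i j (r * g k j) * \<gamma> k)" for i j \<gamma>
    by (simp add: sum_distrib_left mult_scaleC_right lin mult.commute)
  have lincomb_e: "(\<Sum>k<n. \<gamma> k *\<^sub>C g k j) * e j = (\<Sum>k<n. \<gamma> k *\<^sub>C g k j)" if "j < n" for j \<gamma>
    using g[OF that] by (simp add: sum_distrib_right mult_scaleC_left)
  define c where "c = l *\<^sub>C (a * r)"
  have cw: "c * w = l *\<^sub>C (\<Sum>i<n. \<phi> i j (r * w) *\<^sub>C g i j)" if "j < n" "w * e j = w" for j w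
  proof -
    have "c * w = l *\<^sub>C (a * (r * w) * e j)"
      unfolding c_def using that(2) by (simp add: mult_scaleC_left mult.assoc)
    then show ?thesis unfolding rank[OF that(1)] .
  qed
  {
    assume unit: "unit_elem (1 - l *\<^sub>C (a * r))"
    show "\<forall>j<n. fredholm_det n (\<lambda>i k. \<phi> i j (r * g k j)) l \<noteq> 0"
    proof (intro allI impI notI)
      fix j assume j: "j < n" and "fredholm_det n (\<lambda>i k. \<phi> i j (r * g k j)) l = 0"
      then obtain \<gamma> i where \<gamma>: "i < n" "\<gamma> i \<noteq> 0"
        "\<And>i. i < n \<Longrightarrow> \<gamma> i = l * (\<Sum>k<n. \<phi> i j (r * g k j) * \<gamma> k)"
        unfolding fredholm_det_eq_0_iff by blast
      \<comment> \<open>The kernel vector yields a fixed point \<open>w\<close> of left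
        multiplication by \<open>c\<close>. Its functionals recover \<gamma>, so \<open>w\<close>
        cannot be 0.\<close>
      define w where "w = (\<Sum>k<n. \<gamma> k *\<^sub>C g k j)"
      have \<phi>w: "l * \<phi> i j (r * w) = \<gamma> i" if "i < n" for i
        unfolding w_def lincomb using \<gamma>(3)[OF that] by simp
      have "c * w = (\<Sum>i<n. (l * \<phi> i j (r * w)) *\<^sub>C g i j)"
        using cw[OF j] lincomb_e[OF j] unfolding w_def
        by (simp add: complex_vector.scale_sum_right scaleC_scaleC)
      also have "\<dots> = w" using \<phi>w unfolding w_def by simp
      finally have "(1 - c) * w = 0" by (simp add: left_diff_distrib)
      moreover obtain q where "q * (1 - c) = 1"
        using unit unfolding unit_elem_def inverse_of_def c_def by blast
      ultimately have "w = 0" by (metis mult.assoc mult_1_left mult_zero_right)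
      then show False using \<phi>w[OF \<gamma>(1)] \<gamma>(2) by (simp add: lin)
    qed
  next
    assume det: "\<forall>j<n. fredholm_det n (\<lambda>i k. \<phi> i j (r * g k j)) l \<noteq> 0"
    \<comment> \<open>The values \<open>s i\<close> of the functionals at a fixed point solve the
      homogeneous system, so they vanish, and \<open>w\<close> is a combination with these
      coefficients.\<close>
    have inj: "w = 0" if j: "j < n" and w: "w * e j = w" "c * w = w" for j w
    proof -
      define s where "s i = \<phi> i j (r * w)" for i
      have w': "w = l *\<^sub>C (\<Sum>i<n. s i *\<^sub>C g i j)" using cw[OF j w(1)] w(2) unfolding s_def by simp
      have "s i = l * (\<Sum>k<n. \<phi> i j (r * g k j) * s k)" for i
      proof -
        have "s i = \<phi> i j (r * (l *\<^sub>C (\<Sum>i<n. s i *\<^sub>C g i j)))"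
          unfolding s_def[of i] by (simp only: w'[symmetric])
        also have "\<dots> = l * (\<Sum>k<n. \<phi> i j (r * g k j) * s k)"
          unfolding mult_scaleC_right lin(2) lincomb ..
        finally show ?thesis .
      qed
      then have "\<forall>i<n. s i = 0"
        using det j fredholm_det_eq_0_iff[of n "\<lambda>i k. \<phi> i j (r * g k j)" l] by blast
      then show ?thesis by (subst w') simp
    qed
    have "\<exists>t. t * e j = t \<and> t = u j * e j + c * t" if j: "j < n" for j
    proof -
      define y where "y = u j * e j"
      have y: "y * e j = y" unfolding y_def using e[OF j] by (simp add: mult.assoc)
      obtain \<gamma> where \<gamma>: "\<And>i. i < n \<Longrightarrow> \<gamma> i = \<phi> i j (r * y) + l * (\<Sum>k<n. \<phi> i j (r * g k j) * \<gamma> k)"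
        using fredholm_det_solve[of n "\<lambda>i k. \<phi> i j (r * g k j)" l "\<lambda>i. \<phi> i j (r * y)"] det j by blast
      \<comment> \<open>A solution of \<open>t = y + c * t\<close> differs from \<open>y\<close> by
        a combination of the \<open>g k j\<close>; the linear system determines its
        coefficients.\<close>
      define t where "t = y + l *\<^sub>C (\<Sum>k<n. \<gamma> k *\<^sub>C g k j)"
      have te: "t * e j = t"
        unfolding t_def distrib_right mult_scaleC_left lincomb_e[OF j] y ..
      have "\<phi> i j (r * t) = \<gamma> i" if "i < n" for i
        unfolding t_def distrib_left mult_scaleC_right lin(1,2) lincomb using \<gamma>[OF that] by simp
      then have "c * t = l *\<^sub>C (\<Sum>k<n. \<gamma> k *\<^sub>C g k j)"
        unfolding cw[OF j te] by simp
      then have "t = u j * e j + c * t" unfolding t_def y_def by simp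
      then show ?thesis using te by blast
    qed
    then obtain t where t: "\<And>j. j < n \<Longrightarrow> t j * e j = t j" "\<And>j. j < n \<Longrightarrow> t j = u j * e j + c * t j"
      by metis
    define T where "T = (\<Sum>j<n. t j)"
    define b where "b = l *\<^sub>C r"
    have cb: "c = a * b" unfolding c_def b_def by (simp add: mult_scaleC_right)
    have "T = (\<Sum>j<n. u j * e j + c * t j)" unfolding T_def using t(2) by (intro sum.cong) auto
    also have "\<dots> = a + c * T" by (simp only: sum.distrib sum_distrib_left a T_def)
    finally have T: "T - c * T = a" by (metis add_diff_cancel_right')
    \<comment> \<open>Since \<open>T\<close> solves \<open>(1 - c) * T = a\<close> and
      \<open>c = a * b\<close>, the candidate inverse of \<open>1 - c\<close> is
      \<open>1 + T * b\<close>.\<close>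
    have "(1 - c) * (1 + T * b) = 1 - c + (T - c * T) * b"
      by (simp add: algebra_simps)
    then have right: "(1 - c) * (1 + T * b) = 1" unfolding T by (simp add: cb)
    \<comment> \<open>The right inverse shows that \<open>1 - c\<close> annihilates this element, so
      injectivity makes it 0. The sum over \<open>j\<close> is the identity that turns
      \<open>1 + T * b\<close> into a left inverse.\<close>
    have zero: "t j - u j * e j - T * b * (u j * e j) = 0" if j: "j < n" for j
    proof (rule inj[OF j])
      let ?s = "t j - u j * e j - T * b * (u j * e j)"
      show "?s * e j = ?s" using t(1)[OF j] e[OF j] by (simp add: left_diff_distrib mult.assoc)
      have "(1 - c) * ?s = (t j - c * t j) - ((1 - c) * (1 + T * b)) * (u j * e j)"
        by (simp add: algebra_simps)
      also have "t j - c * t j = u j * e j" using t(2)[OF j] by (simp add: algebra_simps)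
      finally have "(1 - c) * ?s = 0" unfolding right by simp
      then show "c * ?s = ?s" by (simp add: left_diff_distrib)
    qed
    have "(\<Sum>j<n. t j - u j * e j - T * b * (u j * e j)) = T - a - T * b * a"
      unfolding sum_subtractf sum_distrib_left[symmetric] T_def[symmetric] a[symmetric] ..
    then have "T - a - T * b * a = 0" using zero by simp
    moreover have "(1 + T * b) * (1 - a * b) = 1 + (T - a - T * b * a) * b"
      by (simp add: algebra_simps)
    ultimately have "(1 + T * b) * (1 - c) = 1" unfolding cb by simp
    with right show "unit_elem (1 - l *\<^sub>C (a * r))"
      unfolding unit_elem_def inverse_of_def c_def by blast
  }
qed

section \<open>The determinant of a socle perturbation\<close>

lemma spectrum_perturbed_iff:
  assumes z: "z \<in> - spectrum x"
  shows "z \<in> spectrum (x + l *\<^sub>C a) \<longleftrightarrow> \<not> unit_elem (1 - l *\<^sub>C (a * resolvent x z))"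
proof -
  have R: "resolvent x z * (z *\<^sub>C 1 - x) = 1"
    using inverse_of_resolvent[OF z] unfolding inverse_of_def by simp
  have "(1 - l *\<^sub>C (a * resolvent x z)) * (z *\<^sub>C 1 - x)
      = z *\<^sub>C 1 - x - l *\<^sub>C (a * (resolvent x z * (z *\<^sub>C 1 - x)))"
    by (simp only: left_diff_distrib[of 1] mult_1_left mult_scaleC_left mult.assoc)
  also have "\<dots> = z *\<^sub>C 1 - (x + l *\<^sub>C a)" unfolding R by simp
  finally have *: "(1 - l *\<^sub>C (a * resolvent x z)) * (z *\<^sub>C 1 - x) = z *\<^sub>C 1 - (x + l *\<^sub>C a)" .
  have "unit_elem (z *\<^sub>C 1 - x)" using z by (simp add: spectrum_iff)
  from unit_elem_mult_right_iff[OF this, of "1 - l *\<^sub>C (a * resolvent x z)"]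
  show ?thesis unfolding * spectrum_iff by blast
qed

text \<open>\<open>D\<close> multiplies one determinant for each left ideal generated by some
  \<open>e j\<close>, so it vanishes exactly when one of them does; \<open>P\<close> is its
  expansion around \<open>l = 1\<close>.\<close>

lemma soc_perturbation_determinant:
  fixes a x :: "'a::complex_banach_algebra_1"
  assumes ss: "jacobson_radical = {0 :: 'a}" and a: "a \<in> soc"
  obtains D P where
    "\<And>z l. z \<in> - spectrum x \<Longrightarrow> z \<in> spectrum (x + l *\<^sub>C a) \<longleftrightarrow> D z l = 0"
    "\<And>l. (\<lambda>z. D z l) holomorphic_on - spectrum x" "\<And>z. D z 0 = 1"
    "continuous_poly_family (- spectrum x) P" "\<And>z s. poly (P z) s = D z (1 + s)"
proof (rule soc_finite_rank[OF ss a])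
  fix n :: nat and u e :: "nat \<Rightarrow> 'a" and \<phi> :: "nat \<Rightarrow> nat \<Rightarrow> 'a \<Rightarrow> complex"
    and g :: "nat \<Rightarrow> nat \<Rightarrow> 'a"
  assume data: "a = (\<Sum>j<n. u j * e j)" "\<And>j. j < n \<Longrightarrow> e j * e j = e j"
    "\<And>i j. cfunctional (\<phi> i j)" "\<And>i j. j < n \<Longrightarrow> g i j * e j = g i j"
    "\<And>w j. j < n \<Longrightarrow> a * w * e j = (\<Sum>i<n. \<phi> i j w *\<^sub>C g i j)"
  define A where "A j z = (\<lambda>i k. \<phi> i j (resolvent x z * g k j))" for j z
  define D where "D z l = (\<Prod>j<n. fredholm_det n (A j z) l)" for z l
  have holA: "(\<lambda>z. A j z i k) holomorphic_on - spectrum x" for i j k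
    unfolding A_def by (rule holomorphic_on_functional_resolvent) (rule data)
  have "\<exists>P. continuous_poly_family (- spectrum x) P \<and> (\<forall>z s. poly (P z) s = fredholm_det n (A j z) (1 + s))" for j
    using fredholm_det_poly_family[of n "- spectrum x" "A j"] holA holomorphic_on_imp_continuous_on
    by metis
  then obtain P where P: "\<And>j. continuous_poly_family (- spectrum x) (P j)"
    "\<And>j z s. poly (P j z) s = fredholm_det n (A j z) (1 + s)" by metis
  show thesis
  proof (rule that[of D "\<lambda>z. \<Prod>j<n. P j z"])
    show "z \<in> spectrum (x + l *\<^sub>C a) \<longleftrightarrow> D z l = 0" if "z \<in> - spectrum x" for z l
    proof -
      have "unit_elem (1 - l *\<^sub>C (a * resolvent x z)) \<longleftrightarrow> (\<forall>j<n. fredholm_det n (A j z) l \<noteq> 0)"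
        unfolding A_def
        by (rule unit_elem_iff_fredholm_det[where n = n and u = u and e = e and \<phi> = \<phi> and g = g, OF data])
      then show ?thesis unfolding spectrum_perturbed_iff[OF that] D_def by auto
    qed
    show "(\<lambda>z. D z l) holomorphic_on - spectrum x" for l
      unfolding D_def by (intro holomorphic_intros holomorphic_on_fredholm_det holA)
    show "D z 0 = 1" for z unfolding D_def by (simp add: fredholm_det_0)
    show "continuous_poly_family (- spectrum x) (\<lambda>z. \<Prod>j<n. P j z)"
      by (intro continuous_poly_family_prod P)
    show "poly (\<Prod>j<n. P j z) s = D z (1 + s)" for z s
      unfolding D_def poly_prod P ..
  qed
qed

section \<open>Holes and discontinuity\<close>

lemma hausdorff_distance_ge_infdist:
  fixes K L :: "'b::metric_space set"
  assumes "bounded L" "K \<noteq> {}" "z \<in> L"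
  shows "infdist z K \<le> hausdorff_distance K L"
proof -
  obtain k where k: "k \<in> K" using assms by blast
  obtain B where B: "\<And>w. w \<in> L \<Longrightarrow> dist k w \<le> B" using assms(1) bounded_any_center by metis
  \<comment> \<open>Boundedness guarantees that the supremum is a genuine upper bound.\<close>
  have "bdd_above ((\<lambda>w. infdist w K) ` L)"
    using B infdist_le[OF k] by (intro bdd_aboveI2[of _ _ B]) (metis dist_commute order_trans)
  then have "infdist z K \<le> (SUP z\<in>L. infdist z K)" using assms(3) by (intro cSUP_upper)
  then show ?thesis unfolding hausdorff_distance_def by simp
qed

lemma hole_filled_imp_discontinuous:
  fixes a x :: "'a::complex_banach_algebra_1"
  assumes ss: "jacobson_radical = {0 :: 'a}" and a: "a \<in> soc"
    and H: "hole H (spectrum x)" and filled: "H \<subseteq> spectrum (x + a)"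
  shows "\<not> spectrum_continuous_at (x + a)"
proof
  assume cont: "spectrum_continuous_at (x + a)"
  have comp: "H \<in> components (- spectrum x)" using H unfolding hole_def by simp
  then have Ho: "open H" "H \<noteq> {}" "H \<subseteq> - spectrum x"
    using open_components open_resolvent_set in_components_nonempty in_components_subset by blast+
  obtain D P where D: "\<And>z l. z \<in> - spectrum x \<Longrightarrow> z \<in> spectrum (x + l *\<^sub>C a) \<longleftrightarrow> D z l = 0"
    "\<And>z. D z 0 = 1" and P: "continuous_poly_family (- spectrum x) P" "\<And>z s. poly (P z) s = D z (1 + s)"
    using soc_perturbation_determinant[OF ss a, of x] by metis
  have PH: "continuous_poly_family H P"
    using P(1) Ho(3) continuous_on_subset unfolding continuous_poly_family_def by blast
  obtain z1 where z1: "z1 \<in> H" using Ho by blast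
  \<comment> \<open>The value \<open>s = - 1\<close> corresponds to \<open>l = 0\<close>, where the
    determinant is 1.\<close>
  have "poly (P z1) (- 1) = 1" using P(2)[of z1 "- 1"] D(2) by simp
  then have "P z1 \<noteq> 0" by auto
  from poly_family_nonzero_near_0[OF PH Ho(1) z1 this]
  obtain z r where z: "z \<in> H" "r > 0"
    "\<And>w s. dist w z < r \<Longrightarrow> 0 < cmod s \<Longrightarrow> cmod s < r \<Longrightarrow> w \<in> H \<and> poly (P w) s \<noteq> 0" by metis
  \<comment> \<open>The spectrum of the nearby element misses the ball of radius \<open>r\<close>
    around \<open>z\<close>, although \<open>z\<close> belongs to the spectrum of
    \<open>x + a\<close>.\<close>
  have far: "r \<le> hausdorff_distance (spectrum (x + (1 + s) *\<^sub>C a)) (spectrum (x + a))"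
    if s: "0 < cmod s" "cmod s < r" for s
  proof -
    let ?K = "spectrum (x + (1 + s) *\<^sub>C a)"
    have "w \<notin> ?K" if "dist w z < r" for w
      using z(3)[OF that s] D(1)[of w "1 + s"] P(2)[of w s] Ho(3) by auto
    then have "r \<le> dist z w" if "w \<in> ?K" for w using that by (metis dist_commute not_less)
    then have "r \<le> infdist z ?K"
      unfolding infdist_notempty[OF spectrum_nonempty] by (intro cINF_greatest spectrum_nonempty)
    also have "\<dots> \<le> hausdorff_distance ?K (spectrum (x + a))"
      using bounded_spectrum spectrum_nonempty z(1) filled
      by (intro hausdorff_distance_ge_infdist) blast+
    finally show ?thesis .
  qed
  \<comment> \<open>Needed for the path \<open>x + (1 + s) *\<^sub>C a\<close> to avoid
    \<open>x + a\<close> when \<open>s\<close> is nonzero, as the punctured limit requires.\<close>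
  have "a \<noteq> 0"
  proof
    assume "a = 0"
    then have "H \<subseteq> spectrum x" using filled by simp
    then show False using z1 Ho(3) by blast
  qed
  have "((\<lambda>s. x + (1 + s) *\<^sub>C a) \<longlongrightarrow> x + (1 + 0) *\<^sub>C a) (at 0)"
    by (intro tendsto_intros)
  moreover have "\<forall>\<^sub>F s in at 0. x + (1 + s) *\<^sub>C a \<noteq> x + a"
    using \<open>a \<noteq> 0\<close> by (simp add: eventually_at_filter scaleC_add_left scaleC_one)
  ultimately have "filterlim (\<lambda>s. x + (1 + s) *\<^sub>C a) (at (x + a)) (at 0)"
    by (simp add: filterlim_at scaleC_one)
  from filterlim_compose[OF cont[unfolded spectrum_continuous_at_def] this]
  have "\<forall>\<^sub>F s in at 0. hausdorff_distance (spectrum (x + (1 + s) *\<^sub>C a)) (spectrum (x + a)) < r"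
    using z(2) by (rule order_tendstoD(2))
  moreover have "\<forall>\<^sub>F s :: complex in at 0. 0 < cmod s \<and> cmod s < r"
    using z(2) by (auto simp: eventually_at intro!: exI[of _ r])
  ultimately have "\<forall>\<^sub>F s :: complex in at 0. False"
    by eventually_elim (use far in force)
  then show False by simp
qed

text \<open>On \<open>U\<close> the spectrum of \<open>x + a\<close> is the zero set of a
  holomorphic function that is not identically 0. Its zeros are isolated, and removing such a sparse
  set from a connected open subset of the plane preserves connectedness.\<close>

lemma resolvent_component_minus_spectrum:
  fixes a x :: "'a::complex_banach_algebra_1"
  assumes ss: "jacobson_radical = {0 :: 'a}" and a: "a \<in> soc"
    and U: "open U" "connected U" "U \<subseteq> - spectrum x" and nU: "\<not> U \<subseteq> spectrum (x + a)"
  shows "z \<in> U \<Longrightarrow> z \<in> spectrum (x + a) \<Longrightarrow> z isolated_in spectrum (x + a)"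
    and "connected (U - spectrum (x + a))"
proof -
  obtain D where D: "\<And>z l. z \<in> - spectrum x \<Longrightarrow> z \<in> spectrum (x + l *\<^sub>C a) \<longleftrightarrow> D z l = 0"
    "\<And>l. (\<lambda>z. D z l) holomorphic_on - spectrum x"
    using soc_perturbation_determinant[OF ss a, of x] by metis
  have D1: "w \<in> spectrum (x + a) \<longleftrightarrow> D w 1 = 0" if "w \<in> U" for w
    using D(1)[of w 1] that U(3) by (auto simp: scaleC_one)
  have hol: "(\<lambda>z. D z 1) holomorphic_on U" using D(2) U(3) holomorphic_on_subset by blast
  obtain b where b: "b \<in> U" "D b 1 \<noteq> 0" using nU D1 by blast
  have iso: "z isolated_in spectrum (x + a)" if z: "z \<in> U" "z \<in> spectrum (x + a)" for z
  proof -
    have "D z 1 = 0" using D1 z by blast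
    from isolated_zeros[OF hol U(1,2) z(1) this b]
    obtain r where r: "0 < r" "ball z r \<subseteq> U" "\<And>w. w \<in> ball z r - {z} \<Longrightarrow> D w 1 \<noteq> 0" by blast
    then have "w = z" if "w \<in> spectrum (x + a)" "dist z w < r" for w
      using that D1[of w] by (metis DiffI mem_ball singletonD subsetD)
    then show ?thesis unfolding isolated_in_dist_Ex_iff using z(2) r(1) by blast
  qed
  then show "z \<in> U \<Longrightarrow> z \<in> spectrum (x + a) \<Longrightarrow> z isolated_in spectrum (x + a)" .
  have "\<forall>\<^sub>F w in at z. w \<notin> spectrum (x + a)" if "z \<in> U" for z
  proof (cases "z \<in> spectrum (x + a)")
    case True
    from iso[OF \<open>z \<in> U\<close> this] show ?thesis
      by (simp add: isolated_in_islimpt_iff islimpt_iff_eventually)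
  next
    case False
    then show ?thesis
      using eventually_at_in_open'[OF open_resolvent_set, of z "x + a"] by simp
  qed
  then have "spectrum (x + a) sparse_in U" by (simp add: sparse_in_eventually_iff U(1))
  then show "connected (U - spectrum (x + a))" using U by (intro sparse_imp_connected) simp_all
qed

text \<open>The preceding lemma is used in both directions. From \<open>x + a\<close> with
  \<open>- a\<close>, the set \<open>H - spectrum x\<close> is connected and so lies in one
  component \<open>H'\<close> of the resolvent set of \<open>x\<close>; from \<open>x\<close> with
  \<open>a\<close>, \<open>H'\<close> exceeds \<open>H\<close> only by isolated points of
  \<open>spectrum (x + a)\<close>.\<close>

lemma hole_up_to_isolated_if_not_filled:
  fixes a x :: "'a::complex_banach_algebra_1"
  assumes ss: "jacobson_radical = {0 :: 'a}" and a: "a \<in> soc"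
    and H: "hole H (spectrum (x + a))" and nH: "\<not> H \<subseteq> spectrum x"
  shows "hole_up_to_isolated H (spectrum x) (spectrum (x + a))"
proof -
  let ?y = "x + a"
  have ma: "- a \<in> soc" using left_idealD(4)[OF left_ideal_soc a] .
  have Hc: "H \<in> components (- spectrum ?y)" "bounded H" using H unfolding hole_def by auto
  then have HU: "open H" "connected H" "H \<subseteq> - spectrum ?y"
    using open_components open_resolvent_set in_components_connected in_components_subset by blast+
  have isoH: "z isolated_in spectrum x" if "z \<in> H" "z \<in> spectrum x" for z
    using resolvent_component_minus_spectrum(1)[OF ss ma HU, of z] nH that by simp
  have conH: "connected (H - spectrum x)"
    using resolvent_component_minus_spectrum(2)[OF ss ma HU] nH by simp
  obtain p where p: "p \<in> H" "p \<notin> spectrum x" using nH by blast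
  define H' where "H' = connected_component_set (- spectrum x) p"
  have H'c: "H' \<in> components (- spectrum x)" unfolding H'_def components_def using p by blast
  then have H'U: "open H'" "connected H'" "H' \<subseteq> - spectrum x"
    using open_components open_resolvent_set in_components_connected in_components_subset by blast+
  have pH': "p \<in> H'" unfolding H'_def using p by simp
  have sub: "H - spectrum x \<subseteq> H'"
    unfolding H'_def using conH p by (intro connected_component_maximal) auto
  have nH': "\<not> H' \<subseteq> spectrum ?y" using pH' p HU(3) by blast
  have "H' - spectrum ?y \<subseteq> H"
  proof (rule components_maximal[OF Hc(1)])
    show "connected (H' - spectrum ?y)"
      by (rule resolvent_component_minus_spectrum(2)[OF ss a H'U nH'])
    show "H \<inter> (H' - spectrum ?y) \<noteq> {}" using p pH' HU(3) by blast
  qed blast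
  then have "H' \<subseteq> H \<union> spectrum ?y" by blast
  then have "bounded H'" using Hc(2) bounded_spectrum bounded_subset by (metis bounded_Un)
  then have "hole H' (spectrum x)" unfolding hole_def using H'c by blast
  moreover have "H - H' \<subseteq> {z. z isolated_in spectrum x}" using sub isoH by blast
  moreover have "H' - H \<subseteq> {z. z isolated_in spectrum ?y}"
    using resolvent_component_minus_spectrum(1)[OF ss a H'U nH'] \<open>H' \<subseteq> H \<union> spectrum ?y\<close> by blast
  ultimately show ?thesis unfolding hole_up_to_isolated_def by blast
qed

theorem theorem2p1:
  assumes "semisimple TYPE('a::complex_banach_algebra_1)"
    and "complex_dim_gt_one TYPE('a)"
  shows "(\<forall>(x::'a) H. hole H (spectrum x) \<longrightarrow>
            (\<forall>a\<in>soc. H \<subseteq> spectrum (x + a) \<longrightarrow> \<not> spectrum_continuous_at (x + a)))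
       \<and> (\<forall>x::'a. (\<exists>H. \<exists>a\<in>soc. hole H (spectrum (x + a)) \<and>
                      \<not> hole_up_to_isolated H (spectrum x) (spectrum (x + a)))
            \<longrightarrow> \<not> spectrum_continuous_at x)"
proof -
  have ss: "jacobson_radical = {0 :: 'a}" using assms(1) unfolding semisimple_def .
  have "\<not> spectrum_continuous_at x"
    if "a \<in> soc" "hole H (spectrum (x + a))"
      "\<not> hole_up_to_isolated H (spectrum x) (spectrum (x + a))" for x a :: 'a and H
  proof -
    \<comment> \<open>The first claim is applied at base point \<open>x + a\<close> with
      perturbation \<open>- a\<close>; a hole that is not filled would persist up to isolated
      points.\<close>
    have "H \<subseteq> spectrum (x + a + - a)"
      using hole_up_to_isolated_if_not_filled[OF ss that(1,2)] that(3) by auto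
    from hole_filled_imp_discontinuous[OF ss left_idealD(4)[OF left_ideal_soc that(1)] that(2) this]
    show ?thesis by simp
  qed
  then show ?thesis using hole_filled_imp_discontinuous[OF ss] by blast
qed

end
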